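(* Let $\mathbb P$ be a Bernoulli measure on $\partial\mathcal M$ and $\varphi:\Sigma\to\mathbb R$ a cost function. For every exhaustive AST $V$ with $\mathbb E|V|<\infty$, with iterated sequence $(V_n)_{n\ge0}$, the ergodic means $M_{V,n}\varphi=\langle\varphi,\xi_{V_n}\rangle/|\xi_{V_n}|$ converge $\mathbb P$-a.s. as $n\to\infty$ to a constant; moreover this constant is the same for all exhaustive ASTs $V$ with $\mathbb E|V|<\infty$.
   Context: Let $\Sigma$ be a finite set with at least two elements and $I\subseteq\Sigma\times\Sigma$ a symmetric irreflexive relation such that $(\Sigma,(\Sigma\times\Sigma)\setminus I)$ is connected. The heap monoid $\mathcal M=\mathcal M(\Sigma,I)$ is $\Sigma^*$ modulo the smallest congruence containing $(ab,ba)$ for $(a,b)\in I$; $\cdot$ is concatenation, $0$ the empty heap, $|x|$ the length. $x\le y$ iff $y=x\cdot z$ for some $z$. Cliques are heaps formed by distinct pairwise independent pieces; $\mathfrak C$ the nonempty ones; $\gamma\to\gamma'$ iff each piece of $\gamma'$ is dependent on some piece of $\gamma$. Every nonempty heap has a unique Cartier–Foata decomposition $\gamma_1\cdots\gamma_n$ with $\gamma_i\in\mathfrak C$, $\gamma_i\to\gamma_{i+1}$. The boundary $\partial\mathcal M$ is the set of infinite sequences $(\gamma_n)_{n\ge1}$ of nonempty cliques with $\gamma_n\to\gamma_{n+1}$; $\overline{\mathcal M}=\mathcal M\cup\partial\mathcal M$ (finite heaps padded with empty cliques), ordered by $\xi\le\xi'$ iff $\gamma_1\cdots\gamma_n\le\gamma'_1\cdots\gamma'_n$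 for all $n$; nondecreasing sequences have least upper bounds $\bigvee$. $|\xi|=\infty$ for infinite $\xi$. ${\uparrow}x=\{\xi\in\partial\mathcal M:x\le\xi\}$; $\mathcal F$ the generated $\sigma$-algebra. A Bernoulli measure is a probability $\mathbb P$ on $(\partial\mathcal M,\mathcal F)$ with $\mathbb P({\uparrow}(x\cdot y))=\mathbb P({\uparrow}x)\mathbb P({\uparrow}y)$ and $\mathbb P({\uparrow}x)>0$ for all $x,y$; $\mathbb E$ its expectation. An AST is a map $V:\partial\mathcal M\to\overline{\mathcal M}$, $\xi\mapsto\xi_V$, with (i) $\xi_V\le\xi$ and (ii) if $|\xi_V|<\infty$ and $\xi_V\le\xi'$ then $\xi'_V=\xi_V$; $|V|$ denotes $|\xi_V|$. For $x\in\mathcal M$, $\xi\mapsto x\cdot\xi=\bigvee_n x\cdot\gamma_1\cdots\gamma_n$ is a bijection $\partial\mathcal M\to{\uparrow}x$ with inverse $\xi\mapsto\xi-x$. Iterated sequence: $V_0=0$, $V_{n+1}(\xi)=\xi$ if $V_n(\xi)\in\partial\mathcal M$, else $V_{n+1}(\xi)=V_n(\xi)\cdot V(\xi-V_n(\xi))$. $V$ is exhaustive if $\xi_V\in\mathcal M$ for $\mathbb P$-a.e. $\xi$ and $\xi=\bigvee_nV_n(\xi)$ for $\mathbb P$-a.e. $\xi$. For $\varphi:\Sigma\to\mathbb R$ and a heap $x$ with representative word $x_1\cdots x_k$, $\langle\varphi,x\rangle=\varphi(x_1)+\dots+\varphi(x_k)$ (independent of the representative). *)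

theory Defs
  imports "HOL-Probability.Probability"
begin

text \<open>Heap monoid over a finite alphabet of type 'a with independence relation I.
  Finite heaps and infinite heaps are both represented by their (padded)
  Cartier-Foata sequences of cliques, of type nat => 'a set.\<close>

type_synonym 'a cfseq = "nat \<Rightarrow> 'a set"

definition swap1 :: "('a \<times> 'a) set \<Rightarrow> 'a list \<Rightarrow> 'a list \<Rightarrow> bool" where
  "swap1 I u v \<longleftrightarrow> (\<exists>x y a b. (a, b) \<in> I \<and> u = x @ [a, b] @ y \<and> v = x @ [b, a] @ y)"

definition heq :: "('a \<times> 'a) set \<Rightarrow> 'a list \<Rightarrow> 'a list \<Rightarrow> bool" where
  "heq I = equivclp (swap1 I)"

definition hle :: "('a \<times> 'a) set \<Rightarrow> 'a list \<Rightarrow> 'a list \<Rightarrow> bool" where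
  "hle I u v \<longleftrightarrow> (\<exists>z. heq I (u @ z) v)"

definition clique :: "('a \<times> 'a) set \<Rightarrow> 'a set \<Rightarrow> bool" where
  "clique I c \<longleftrightarrow> (\<forall>a\<in>c. \<forall>b\<in>c. a \<noteq> b \<longrightarrow> (a, b) \<in> I)"

definition carrow :: "('a \<times> 'a) set \<Rightarrow> 'a set \<Rightarrow> 'a set \<Rightarrow> bool" where
  "carrow I c c' \<longleftrightarrow> (\<forall>b\<in>c'. \<exists>a\<in>c. (a, b) \<notin> I)"

(* \<overline>M : Cartier-Foata sequences, finite heaps padded with empty cliques *)
definition Mbar :: "('a \<times> 'a) set \<Rightarrow> 'a cfseq set" where
  "Mbar I = {g. \<forall>n. clique I (g n) \<and> carrow I (g n) (g (Suc n))}"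

definition fheaps :: "('a \<times> 'a) set \<Rightarrow> 'a cfseq set" where
  "fheaps I = {g \<in> Mbar I. \<exists>n. g n = {}}"

definition bdry :: "('a \<times> 'a) set \<Rightarrow> 'a cfseq set" where
  "bdry I = {g \<in> Mbar I. \<forall>n. g n \<noteq> {}}"

definition hzero :: "'a cfseq" where
  "hzero = (\<lambda>n. {})"

definition clist :: "'a set \<Rightarrow> 'a list" where
  "clist c = (SOME w. distinct w \<and> set w = c)"

definition pword :: "'a cfseq \<Rightarrow> nat \<Rightarrow> 'a list" where
  "pword g n = concat (map (\<lambda>i. clist (g i)) [0..<n])"

definition trunc :: "'a cfseq \<Rightarrow> nat \<Rightarrow> 'a cfseq" where
  "trunc g n = (\<lambda>i. if i < n then g i else {})"

definition fword :: "'a cfseq \<Rightarrow> 'a list" where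
  "fword g = pword g (LEAST n. g n = {})"

definition heap_of :: "('a \<times> 'a) set \<Rightarrow> 'a list \<Rightarrow> 'a cfseq" where
  "heap_of I w = (THE g. g \<in> fheaps I \<and> heq I w (fword g))"

definition hcat :: "('a \<times> 'a) set \<Rightarrow> 'a cfseq \<Rightarrow> 'a cfseq \<Rightarrow> 'a cfseq" where
  "hcat I x y = heap_of I (fword x @ fword y)"

definition mle :: "('a \<times> 'a) set \<Rightarrow> 'a cfseq \<Rightarrow> 'a cfseq \<Rightarrow> bool" where
  "mle I g g' \<longleftrightarrow> (\<forall>n. hle I (pword g n) (pword g' n))"

definition is_lub :: "('a \<times> 'a) set \<Rightarrow> 'a cfseq set \<Rightarrow> 'a cfseq \<Rightarrow> bool" where
  "is_lub I S z \<longleftrightarrow> z \<in> Mbar I \<and> (\<forall>s\<in>S. mle I s z) \<and>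
     (\<forall>z'\<in>Mbar I. (\<forall>s\<in>S. mle I s z') \<longrightarrow> mle I z z')"

definition Lub :: "('a \<times> 'a) set \<Rightarrow> 'a cfseq set \<Rightarrow> 'a cfseq" where
  "Lub I S = (THE z. is_lub I S z)"

definition hmult :: "('a \<times> 'a) set \<Rightarrow> 'a cfseq \<Rightarrow> 'a cfseq \<Rightarrow> 'a cfseq" where
  "hmult I x g = Lub I (range (\<lambda>n. hcat I x (trunc g n)))"

(* xi - x : inverse of xi \<mapsto> x . xi, from \<up>x to \<partial>M *)
definition hminus :: "('a \<times> 'a) set \<Rightarrow> 'a cfseq \<Rightarrow> 'a cfseq \<Rightarrow> 'a cfseq" where
  "hminus I g x = (THE z. z \<in> bdry I \<and> hmult I x z = g)"

definition hsize :: "'a cfseq \<Rightarrow> nat" where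
  "hsize g = length (fword g)"

definition hlen :: "('a \<times> 'a) set \<Rightarrow> 'a cfseq \<Rightarrow> ennreal" where
  "hlen I g = (if g \<in> fheaps I then of_nat (hsize g) else \<infinity>)"

definition cost :: "('a \<Rightarrow> real) \<Rightarrow> 'a cfseq \<Rightarrow> real" where
  "cost \<phi> g = sum_list (map \<phi> (fword g))"

definition up :: "('a \<times> 'a) set \<Rightarrow> 'a cfseq \<Rightarrow> 'a cfseq set" where
  "up I x = {g \<in> bdry I. mle I x g}"

definition bernoulli :: "('a \<times> 'a) set \<Rightarrow> 'a cfseq measure \<Rightarrow> bool" where
  "bernoulli I P \<longleftrightarrow> prob_space P \<and> space P = bdry I \<and>
     sets P = sigma_sets (bdry I) (up I ` fheaps I) \<and>
     (\<forall>x\<in>fheaps I. \<forall>y\<in>fheaps I.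
        measure P (up I (hcat I x y)) = measure P (up I x) * measure P (up I y)) \<and>
     (\<forall>x\<in>fheaps I. measure P (up I x) > 0)"

definition AST :: "('a \<times> 'a) set \<Rightarrow> ('a cfseq \<Rightarrow> 'a cfseq) \<Rightarrow> bool" where
  "AST I V \<longleftrightarrow> (\<forall>g\<in>bdry I. V g \<in> Mbar I \<and> mle I (V g) g) \<and>
     (\<forall>g\<in>bdry I. \<forall>g'\<in>bdry I. V g \<in> fheaps I \<and> mle I (V g) g' \<longrightarrow> V g' = V g)"

fun iterV :: "('a \<times> 'a) set \<Rightarrow> ('a cfseq \<Rightarrow> 'a cfseq) \<Rightarrow> nat \<Rightarrow> 'a cfseq \<Rightarrow> 'a cfseq" where
  "iterV I V 0 g = hzero"
| "iterV I V (Suc n) g =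
     (if iterV I V n g \<in> bdry I then g
      else hmult I (iterV I V n g) (V (hminus I g (iterV I V n g))))"

definition exhaustive :: "('a \<times> 'a) set \<Rightarrow> 'a cfseq measure \<Rightarrow> ('a cfseq \<Rightarrow> 'a cfseq) \<Rightarrow> bool" where
  "exhaustive I P V \<longleftrightarrow> (AE g in P. V g \<in> fheaps I) \<and>
     (AE g in P. g = Lub I (range (\<lambda>n. iterV I V n g)))"

end

theory Submission
  imports Defs
begin

text \<open>
  Write val x for the probability of the cylinder of x and fix a letter a.  A pyramid is a heap with
  exactly one occurrence of a, lying above all its other pieces.  Every heap with k occurrences of a is
  a product of k pyramids and a heap without a.  Cylinders of distinct pyramids are disjoint, so the
  valuation has mass at most 1 on the pyramids.  Since the dependence graph is connected, appending
  a suitable fixed word puts an a on top of any heap; hence the valuation is also summable over the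
  heaps without a, and by submultiplicativity it decays exponentially there.

  Choose c such that the cost \<open>\<phi> - c\<close> has mean 0 over the pyramids.  A Chernoff bound then shows that,
  for each \<open>\<epsilon> > 0\<close>, the valuation is summable over all finite heaps x whose mean cost differs from c by
  at least \<open>\<epsilon>\<close>.  By Borel-Cantelli, almost every infinite heap has only finitely many such subheaps,
  so the mean costs of any sequence of finite subheaps of growing size converge to c.  The heaps
  produced by an exhaustive stopping time almost surely form such a sequence.
\<close>

subsection \<open>Words modulo commutation\<close>

text \<open>Cylinders of different heaps overlap: the valuation summed over all heaps with n pieces
  is the expected number of subheaps of that size, which is at least 1, so a union bound over
  subheaps needs a genuine exponential gain. Fixing a letter restores a renewal structure, because
  an infinite heap has at most one pyramid below it. The Chernoff estimate uses only that the
  pyramids have mass at most 1; equality is never established. It does need exponential moments of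
  the pyramids, and these come from their parts without the letter, which is why summability there
  has to be sharpened to exponential decay. The constant c is a renewal-reward ratio: mean cost of a
  pyramid divided by its mean length. The exceptional null set is fixed before any sequence of
  subheaps is chosen, so one c serves every stopping time.\<close>

lemma heq_refl [simp]: "heq I u u"
  and heq_sym: "heq I u v \<Longrightarrow> heq I v u"
  and heq_trans [trans]: "heq I u v \<Longrightarrow> heq I v w \<Longrightarrow> heq I u w"
  unfolding heq_def by (auto intro: equivclp_sym equivclp_trans)

lemma heq_swap: "(a, b) \<in> I \<Longrightarrow> heq I (x @ a # b # y) (x @ b # a # y)"
  unfolding heq_def by (rule r_into_equivclp) (auto simp: swap1_def)

text \<open>With symmetry and transitivity as separate cases, any relation that is already an
  equivalence has to be checked on a single swap only.\<close>

lemma heq_induct [consumes 1, case_names refl sym trans swap]: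
  assumes "heq I u v" "\<And>u. R u u" "\<And>u v. R u v \<Longrightarrow> R v u" "\<And>u v w. R u v \<Longrightarrow> R v w \<Longrightarrow> R u w"
    "\<And>x y a b. (a, b) \<in> I \<Longrightarrow> R (x @ a # b # y) (x @ b # a # y)"
  shows "R u v"
  using assms(1) unfolding heq_def
proof (induction rule: equivclp_induct)
  case (step y z)
  then have "R y z" using assms(3,5) by (fastforce simp: swap1_def)
  then show ?case using assms(4) step.IH by blast
qed (rule assms(2))

lemma heq_invariant:
  assumes "heq I u v" "\<And>x y a b. (a, b) \<in> I \<Longrightarrow> F (x @ a # b # y) = F (x @ b # a # y)"
  shows "F u = F v"
  using assms(1) by (induction rule: heq_induct) (auto intro: assms(2))

lemma heq_append:
  assumes "heq I u u'" "heq I v v'" shows "heq I (u @ v) (u' @ v')"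
proof -
  have "heq I (u @ v) (u' @ v)" using assms(1)
  proof (induction rule: heq_induct)
    case (swap x y a b)
    then show ?case using heq_swap[of a b I x "y @ v"] by simp
  qed (simp, erule heq_sym, erule (1) heq_trans)
  also have "heq I (u' @ v) (u' @ v')" using assms(2)
  proof (induction rule: heq_induct)
    case (swap x y a b)
    then show ?case using heq_swap[of a b I "u' @ x" y] by simp
  qed (simp, erule heq_sym, erule (1) heq_trans)
  finally show ?thesis .
qed

lemma heq_Cons: "heq I u v \<Longrightarrow> heq I (a # u) (a # v)"
  using heq_append[of I "[a]" "[a]" u v] by simp

lemma heq_mset: "heq I u v \<Longrightarrow> mset u = mset v"
  by (erule heq_invariant) simp

lemma heq_set: "heq I u v \<Longrightarrow> set u = set v"
  using heq_mset mset_eq_setD by blast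

lemma heq_length: "heq I u v \<Longrightarrow> length u = length v"
  using heq_mset mset_eq_length by blast

lemma heq_commute_word:
  assumes "\<And>x. x \<in> set u \<Longrightarrow> (a, x) \<in> I" shows "heq I (a # u @ v) (u @ a # v)"
  using assms
proof (induction u)
  case (Cons b u)
  have "heq I (a # b # u @ v) (b # a # u @ v)" using heq_swap[of a b I "[]"] Cons.prems by simp
  also have "heq I (b # a # u @ v) (b # u @ a # v)" using Cons by (intro heq_Cons) auto
  finally show ?case by simp
qed simp

lemma hleI: "heq I (u @ z) v \<Longrightarrow> hle I u v" by (auto simp: hle_def)

lemma hle_refl [simp]: "hle I u u" by (rule hleI[of _ _ "[]"]) simp

lemma hle_append [simp]: "hle I u (u @ z)" by (rule hleI) (rule heq_refl)

lemma heq_imp_hle: "heq I u v \<Longrightarrow> hle I u v" by (rule hleI[of _ _ "[]"]) simp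

lemma hle_trans [trans]:
  assumes "hle I u v" "hle I v w" shows "hle I u w"
proof -
  obtain z y where z: "heq I (u @ z) v" "heq I (v @ y) w" using assms unfolding hle_def by blast
  then have "heq I (u @ z @ y) (v @ y)" using heq_append[OF z(1), of y y] by simp
  then show ?thesis using z(2) heq_trans hleI by blast
qed

lemma hle_heq_trans: "hle I u v \<Longrightarrow> heq I v w \<Longrightarrow> hle I u w"
  and heq_hle_trans: "heq I u v \<Longrightarrow> hle I v w \<Longrightarrow> hle I u w"
  using hle_trans heq_imp_hle by blast+

lemma hle_length: "hle I u v \<Longrightarrow> length u \<le> length v"
  unfolding hle_def using heq_length by force

lemma hle_length_imp_heq: "hle I u v \<Longrightarrow> length v \<le> length u \<Longrightarrow> heq I u v"
  unfolding hle_def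
proof (elim exE)
  fix z assume z: "heq I (u @ z) v" and "length v \<le> length u"
  then have "length z = 0" using heq_length[OF z] unfolding length_append by linarith
  then have "z = []" by simp
  then show "heq I u v" using z by simp
qed

lemma hle_append_left: "hle I u v \<Longrightarrow> hle I (x @ u) (x @ v)"
  unfolding hle_def using heq_append[OF heq_refl[of I x]] by fastforce

section \<open>Cancellation and common prefixes in the heap monoid\<close>

locale independence =
  fixes I :: "('a \<times> 'a) set"
  assumes sym_I: "sym I" and irrefl_I: "irrefl I"
begin

lemma I_sym: "(a, b) \<in> I \<Longrightarrow> (b, a) \<in> I" using sym_I by (rule symD)
lemma I_irrefl [simp]: "(a, a) \<notin> I" using irrefl_I by (auto simp: irrefl_def)

lemma heq_rev: "heq I u v \<Longrightarrow> heq I (rev u) (rev v)"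
proof (induction rule: heq_induct)
  case (swap x y a b)
  then show ?case using heq_swap[of b a I "rev y" "rev x"] I_sym by simp
qed (simp, erule heq_sym, erule (1) heq_trans)

text \<open>Two swap invariants are at work: whether everything before the first \<open>a\<close> is
  independent of \<open>a\<close>, and the class of the word left after deleting that first
  \<open>a\<close>.\<close>

lemma heq_Cons_split:
  assumes "heq I (a # u) v"
  shows "\<exists>v1 v2. v = v1 @ a # v2 \<and> (\<forall>x\<in>set v1. (a, x) \<in> I) \<and> heq I u (v1 @ v2)"
proof -
  let ?front = "\<lambda>v. a \<in> set v \<and> (\<forall>x\<in>set (takeWhile (\<lambda>x. x \<noteq> a) v). (a, x) \<in> I)"
  have "?front (a # u) = ?front v"
  proof (rule heq_invariant[OF assms, where F = ?front])
    fix x y b c assume bc: "(b, c) \<in> I"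
    show "?front (x @ b # c # y) = ?front (x @ c # b # y)"
    proof (cases "a \<in> set x")
      case True
      then have "takeWhile (\<lambda>x. x \<noteq> a) (x @ z) = takeWhile (\<lambda>x. x \<noteq> a) x" for z by auto
      then show ?thesis using True by simp
    next
      case False
      then have "takeWhile (\<lambda>x. x \<noteq> a) (x @ z) = x @ takeWhile (\<lambda>x. x \<noteq> a) z" for z
        by (subst takeWhile_append2) auto
      then show ?thesis using bc I_sym by auto
    qed
  qed
  then have front: "?front v" by simp
  have rem: "heq I (remove1 a (a # u)) (remove1 a v)" using assms
  proof (induction rule: heq_induct)
    case (swap x y b c)
    then show ?case using heq_swap[of b c I "remove1 a x" y] heq_swap[of b c I x "remove1 a y"]
      by (auto simp: remove1_append)
  qed (simp, erule heq_sym, erule (1) heq_trans)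
  define v1 where "v1 = takeWhile (\<lambda>x. x \<noteq> a) v"
  obtain v2 where v: "v = v1 @ a # v2"
    using front takeWhile_dropWhile_id[of "\<lambda>x. x \<noteq> a" v] hd_dropWhile[of "\<lambda>x. x \<noteq> a" v]
    unfolding v1_def by (metis (mono_tags, lifting) append.right_neutral list.collapse set_takeWhileD)
  have "a \<notin> set v1" unfolding v1_def by (auto dest: set_takeWhileD)
  then have "remove1 a v = v1 @ v2" unfolding v by (simp add: remove1_append)
  then have "heq I u (v1 @ v2)" using rem by simp
  moreover have "\<forall>x\<in>set v1. (a, x) \<in> I" using front by (simp add: v1_def)
  ultimately show ?thesis using v by blast
qed

lemma heq_snoc_split:
  assumes "heq I (u @ [a]) v"
  shows "\<exists>v1 v2. v = v1 @ a # v2 \<and> (\<forall>x\<in>set v2. (a, x) \<in> I) \<and> heq I u (v1 @ v2)"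
proof -
  have "heq I (a # rev u) (rev v)" using heq_rev[OF assms] by simp
  from heq_Cons_split[OF this] obtain w1 w2 where w: "rev v = w1 @ a # w2"
    "\<forall>x\<in>set w1. (a, x) \<in> I" "heq I (rev u) (w1 @ w2)" by blast
  from w(1) have "v = rev w2 @ a # rev w1" by (simp add: rev_swap)
  moreover have "heq I u (rev w2 @ rev w1)" using heq_rev[OF w(3)] by simp
  ultimately show ?thesis using w(2) by (metis set_rev)
qed

lemma heq_cancel_left: "heq I (x @ u) (x @ v) \<Longrightarrow> heq I u v"
proof (induction x)
  case (Cons a x)
  from heq_Cons_split[OF Cons.prems[simplified]] obtain v1 v2 where
    v: "a # x @ v = v1 @ a # v2" "\<forall>y\<in>set v1. (a, y) \<in> I" "heq I (x @ u) (v1 @ v2)" by blast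
  \<comment> \<open>A nonempty \<open>v1\<close> would begin with \<open>a\<close>, which is not
    independent of itself.\<close>
  from v(1,2) have "v1 = []" by (cases v1) auto
  then show ?case using v Cons.IH by simp
qed simp

lemma heq_cancel_right: "heq I (u @ x) (v @ x) \<Longrightarrow> heq I u v"
  using heq_rev[of "u @ x" "v @ x"] heq_cancel_left[of "rev x" "rev u" "rev v"] heq_rev[of "rev u" "rev v"]
  by simp

lemma hle_cancel_left: "hle I (x @ u) (x @ v) \<Longrightarrow> hle I u v"
  unfolding hle_def using heq_cancel_left by (metis append.assoc)

text \<open>The prefix half of Levi's lemma for traces: \<open>c\<close> is the common part, and the
  two remainders commute. Each letter of \<open>u\<close> either occurs in \<open>v\<close> and
  joins \<open>c\<close>, or it commutes with all of \<open>v\<close> and joins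
  \<open>d\<close>.\<close>

lemma levi:
  assumes "heq I (u @ r) (v @ s)"
  shows "\<exists>c d e. heq I u (c @ d) \<and> heq I v (c @ e) \<and> (\<forall>x\<in>set d. \<forall>y\<in>set e. (x, y) \<in> I)"
  using assms
proof (induction u arbitrary: r v s)
  case Nil
  have "heq I [] ([] @ []) \<and> heq I v ([] @ v) \<and> (\<forall>x\<in>set []. \<forall>y\<in>set v. (x, y) \<in> I)" by simp
  then show ?case by blast
next
  case (Cons a u)
  from heq_Cons_split[of a "u @ r" "v @ s"] Cons.prems obtain w1 w2 where
    w: "v @ s = w1 @ a # w2" "\<forall>x\<in>set w1. (a, x) \<in> I" "heq I (u @ r) (w1 @ w2)" by auto
  show ?case
  proof (cases "a \<in> set v")
    case True
    then obtain v1 v2 where v: "v = v1 @ a # v2" "a \<notin> set v1" by (meson split_list_first)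
    have "w1 = v1 \<and> w2 = v2 @ s"
    proof -
      have a: "a \<notin> set w1" using w(2) by auto
      have eq: "w1 @ a # w2 = v1 @ a # (v2 @ s)" using w(1) v by simp
      have tw: "takeWhile (\<lambda>x. x \<noteq> a) (q @ a # r) = q" if "a \<notin> set q" for q r
        using that by (induction q) auto
      have "w1 = v1" using tw[OF a, of w2] tw[OF v(2), of "v2 @ s"] eq by simp
      then show ?thesis using eq by simp
    qed
    then have "heq I (u @ r) ((v1 @ v2) @ s)" and ind: "\<forall>x\<in>set v1. (a, x) \<in> I" using w by auto
    from Cons.IH[OF this(1)] obtain c d e where cde: "heq I u (c @ d)" "heq I (v1 @ v2) (c @ e)"
      "\<forall>x\<in>set d. \<forall>y\<in>set e. (x, y) \<in> I" by blast
    have "heq I v (a # v1 @ v2)" using heq_commute_word[of v1 a I v2] ind v heq_sym by blast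
    also have "heq I \<dots> ((a # c) @ e)" using heq_Cons[OF cde(2)] by simp
    finally have "heq I v ((a # c) @ e)" .
    moreover have "heq I (a # u) ((a # c) @ d)" using heq_Cons[OF cde(1)] by simp
    ultimately show ?thesis using cde(3) by blast
  next
    case False
    then have "\<exists>w. w1 = v @ w"
      using w(1) by (auto simp: append_eq_append_conv2 append_eq_Cons_conv)
    then obtain w where w1: "w1 = v @ w" by blast
    then have "heq I (u @ r) (v @ (w @ w2))" using w(3) by simp
    from Cons.IH[OF this] obtain c d e where cde: "heq I u (c @ d)" "heq I v (c @ e)"
      "\<forall>x\<in>set d. \<forall>y\<in>set e. (x, y) \<in> I" by blast
    have ind: "\<forall>x\<in>set v. (a, x) \<in> I" using w(2) w1 by simp
    have sub: "set c \<subseteq> set v" "set e \<subseteq> set v" using heq_set[OF cde(2)] by auto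
    have "heq I (a # u) (a # c @ d)" using heq_Cons[OF cde(1)] .
    also have "heq I \<dots> (c @ a # d)" using sub ind by (intro heq_commute_word) auto
    finally have "heq I (a # u) (c @ a # d)" .
    moreover have "\<forall>x\<in>set (a # d). \<forall>y\<in>set e. (x, y) \<in> I" using cde(3) sub ind by auto
    ultimately show ?thesis using cde(2) by blast
  qed
qed

subsection \<open>Heaps topped by a given letter\<close>

text \<open>Expresses, without speaking of pieces, that no maximal piece carries a letter other than
  \<open>a\<close>. Further occurrences of \<open>a\<close> below the top are allowed; covering
  words need them.\<close>

definition topped :: "'a \<Rightarrow> 'a list \<Rightarrow> bool" where
  "topped a p \<longleftrightarrow> (\<forall>c d. heq I p (c @ d) \<and> d \<noteq> [] \<longrightarrow> a \<in> set d)"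

lemma topped_cong: "heq I p q \<Longrightarrow> topped a p \<longleftrightarrow> topped a q"
  unfolding topped_def by (meson heq_trans heq_sym)

text \<open>The remainders given by \<open>levi\<close> contain equally many \<open>a\<close>. Both
  cannot contain \<open>a\<close>, since they are independent of each other; hence neither does, and
  being tops of topped heaps both are empty. This is the source of all disjointness of cylinders
  over letter counts.\<close>

lemma topped_unique:
  assumes "topped a p" "topped a q" "count (mset p) a = count (mset q) a" "hle I p w" "hle I q w"
  shows "heq I p q"
proof -
  obtain r s where "heq I (p @ r) w" "heq I (q @ s) w" using assms unfolding hle_def by blast
  then have "heq I (p @ r) (q @ s)" using heq_sym heq_trans by blast
  from levi[OF this] obtain c d e where cde: "heq I p (c @ d)" "heq I q (c @ e)"
    "\<forall>x\<in>set d. \<forall>y\<in>set e. (x, y) \<in> I" by blast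
  have "count (mset d) a = count (mset e) a"
    using assms(3) heq_mset[OF cde(1)] heq_mset[OF cde(2)] by simp
  then have "a \<in> set d \<longleftrightarrow> a \<in> set e" by (metis count_greater_zero_iff set_mset_mset)
  moreover have "d \<noteq> [] \<Longrightarrow> a \<in> set d" "e \<noteq> [] \<Longrightarrow> a \<in> set e"
    using assms(1,2) cde unfolding topped_def by blast+
  moreover have "\<not> (a \<in> set d \<and> a \<in> set e)" using cde(3) I_irrefl by blast
  ultimately have "d = []" "e = []" by auto
  then have "heq I p c" "heq I c q" using cde(1) heq_sym[OF cde(2)] by simp_all
  then show ?thesis by (rule heq_trans)
qed

text \<open>A shortest prefix with exactly one \<open>a\<close> works: a nonempty top part without
  \<open>a\<close> could be cut off.\<close>

lemma topped_prefix:
  assumes "a \<in> set x"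
  shows "\<exists>p y. heq I x (p @ y) \<and> topped a p \<and> count (mset p) a = 1"
proof -
  define Q where "Q p \<longleftrightarrow> (\<exists>y. heq I x (p @ y)) \<and> count (mset p) a = 1" for p
  obtain u v where uv: "x = u @ a # v" "a \<notin> set u" using assms by (meson split_list_first)
  then have "heq I x ((u @ [a]) @ v)" by simp
  moreover have "count (mset (u @ [a])) a = 1" using uv by (simp add: count_mset_0_iff)
  ultimately have "Q (u @ [a])" unfolding Q_def by blast
  from ex_has_least_nat[of Q, OF this, of length]
  obtain p where p: "Q p" and least: "\<And>q. Q q \<Longrightarrow> length p \<le> length q" by blast
  have "topped a p" unfolding topped_def
  proof (intro allI impI, elim conjE, rule ccontr)
    fix c d assume cd: "heq I p (c @ d)" "d \<noteq> []" "a \<notin> set d"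
    obtain y where "heq I x (p @ y)" using p unfolding Q_def by blast
    then have "heq I x (c @ d @ y)" using heq_append[OF cd(1) heq_refl[of I y]] heq_trans by auto
    have "count (mset d) a = 0" using cd(3) by (simp only: count_mset_0_iff not_False_eq_True)
    moreover have "count (mset c) a + count (mset d) a = 1"
      using p heq_mset[OF cd(1)] unfolding Q_def by simp
    ultimately have "count (mset c) a = 1" by linarith
    then have "length p \<le> length c" using \<open>heq I x (c @ d @ y)\<close> by (intro least) (auto simp: Q_def)
    then show False using heq_length[OF cd(1)] cd(2) by simp
  qed
  then show ?thesis using p unfolding Q_def by blast
qed

lemma topped_snoc:
  assumes "topped a p" "count (mset p) a = 1"
  shows "\<exists>u. heq I p (u @ [a]) \<and> a \<notin> set u"
proof -
  have "a \<in> set p" using assms(2) by (metis count_greater_zero_iff less_numeral_extra(1) set_mset_mset)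
  then obtain u v where uv: "p = u @ a # v" "a \<notin> set u" by (meson split_list_first)
  then have "a \<notin> set v" using assms(2) by (simp add: count_mset_0_iff)
  moreover have "heq I p ((u @ [a]) @ v)" using uv by simp
  ultimately have "v = []" using assms(1) unfolding topped_def by blast
  then show ?thesis using uv heq_refl by blast
qed

text \<open>The last letter of \<open>w\<close> does not occur in \<open>d\<close>, so it sits in
  front of \<open>d\<close> on the right-hand side and must commute past it; removing it leaves the
  same situation for a shorter \<open>w\<close>.\<close>

lemma suffix_split_off:
  assumes "heq I (u @ w) (c @ d)" "set w \<inter> set d = {}"
  shows "(\<exists>c'. heq I u (c' @ d)) \<and> (\<forall>x\<in>set w. \<forall>y\<in>set d. (x, y) \<in> I)"
  using assms
proof (induction w arbitrary: c rule: rev_induct)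
  case (snoc b w)
  from heq_snoc_split[of "u @ w" b "c @ d"] snoc.prems obtain v1 v2 where
    v: "c @ d = v1 @ b # v2" "\<forall>x\<in>set v2. (b, x) \<in> I" "heq I (u @ w) (v1 @ v2)" by auto
  from v(1) snoc.prems(2) obtain c2 where c2: "v2 = c2 @ d"
    by (auto simp: append_eq_append_conv2 append_eq_Cons_conv)
  then have "heq I (u @ w) ((v1 @ c2) @ d)" using v(3) by simp
  from snoc.IH[OF this] snoc.prems(2) c2 v(2) show ?case by auto
qed auto

text \<open>A walk in the dependence graph that ends in a and visits every letter puts an occurrence of a
  above every piece of any heap it is appended to.\<close>

lemma covering_word:
  assumes conn: "\<And>b. (b, a) \<in> (- I)\<^sup>*" and fin: "finite (UNIV :: 'a set)"
  shows "\<exists>w. \<forall>z. topped a (z @ w)"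
proof -
  \<comment> \<open>The invariant of a walk that is extended at its front: a top part without
    \<open>a\<close> of any heap ending in \<open>w\<close> avoids every letter of
    \<open>w\<close>.\<close>
  define good where "good w \<longleftrightarrow> w \<noteq> [] \<and> (hd w, a) \<in> (- I)\<^sup>* \<and> a \<in> set w \<and>
    (\<forall>z c d. heq I (z @ w) (c @ d) \<and> a \<notin> set d \<longrightarrow> set w \<inter> set d = {})" for w
  have good_Cons: "good (x # w)" if w: "good w" and x: "(x, hd w) \<notin> I" for x w
  proof -
    have "\<forall>z c d. heq I (z @ x # w) (c @ d) \<and> a \<notin> set d \<longrightarrow> set (x # w) \<inter> set d = {}"
    proof (intro allI impI, elim conjE)
      fix z c d assume h: "heq I (z @ x # w) (c @ d)" "a \<notin> set d"
      have "heq I ((z @ [x]) @ w) (c @ d)" using h by simp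
      moreover from this have dis: "set w \<inter> set d = {}" using w h(2) unfolding good_def by blast
      ultimately have "\<forall>x\<in>set w. \<forall>y\<in>set d. (x, y) \<in> I" using suffix_split_off by blast
      \<comment> \<open>All of \<open>d\<close> is independent of \<open>hd w\<close>, but
        \<open>x\<close> is not.\<close>
      then have "x \<notin> set d" using x w I_sym unfolding good_def by (metis list.set_sel(1))
      then show "set (x # w) \<inter> set d = {}" using dis by simp
    qed
    moreover have "(x, a) \<in> (- I)\<^sup>*" using conn .
    ultimately show ?thesis using w unfolding good_def by simp
  qed
  have reach: "\<exists>w'. good w' \<and> hd w' = x \<and> set w \<subseteq> set w'" if "(x, b) \<in> (- I)\<^sup>*" "good w" "hd w = b" for x b w
    using that
  proof (induction rule: converse_rtrancl_induct)
    case (step y z)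
    then obtain w' where "good w'" "hd w' = z" "set w \<subseteq> set w'" by blast
    then show ?case using good_Cons[of w' y] step(1) by (intro exI[of _ "y # w'"]) auto
  qed auto
  have "\<exists>w. good w \<and> hd w = a \<and> S \<subseteq> set w" if "finite S" for S
    using that
  proof (induction S rule: finite_induct)
    case empty
    have "good [a]" unfolding good_def by auto
    then show ?case by force
  next
    case (insert x S)
    then obtain w where w: "good w" "hd w = a" "S \<subseteq> set w" by blast
    have "sym (- I)" using sym_I by (auto simp: sym_def)
    then have ax: "(a, x) \<in> (- I)\<^sup>*" using conn[of x] by (meson sym_rtrancl symD)
    \<comment> \<open>A detour from \<open>a\<close> to the new letter and back restores the head
      \<open>a\<close> for the next step.\<close>
    obtain w' where w': "good w'" "hd w' = x" "set w \<subseteq> set w'" using reach[OF conn w(1,2)] by blast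
    obtain w'' where w'': "good w''" "hd w'' = a" "set w' \<subseteq> set w''" using reach[OF ax w'(1,2)] by blast
    have "x \<in> set w'" using w' unfolding good_def by auto
    then show ?case using w w' w'' by blast
  qed
  from this[OF fin] obtain w where w: "good w" "set w = UNIV" by auto
  have "topped a (z @ w)" for z
    unfolding topped_def
  proof (intro allI impI, elim conjE, rule ccontr)
    fix c d assume "heq I (z @ w) (c @ d)" "d \<noteq> []" "a \<notin> set d"
    then have "set w \<inter> set d = {}" using w unfolding good_def by blast
    then show False using w \<open>d \<noteq> []\<close> by simp
  qed
  then show ?thesis by blast
qed

end

subsection \<open>Cartier-Foata layers\<close>

locale heaps = independence I for I :: "('a::finite \<times> 'a) set"
begin

text \<open>The state h records, for each letter, the height of its topmost piece; the next piece b is then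
  placed at height level h b.  Keeping only the pieces of height at most n is compatible with
  commutation and monotone, and it truncates a Cartier-Foata sequence at its n-th layer.\<close>

definition level :: "('a \<Rightarrow> nat) \<Rightarrow> 'a \<Rightarrow> nat" where
  "level h b = Suc (Max (h ` {c. (c, b) \<notin> I}))"

definition raise :: "('a \<Rightarrow> nat) \<Rightarrow> 'a \<Rightarrow> 'a \<Rightarrow> nat" where
  "raise h b = h(b := level h b)"

fun low :: "nat \<Rightarrow> ('a \<Rightarrow> nat) \<Rightarrow> 'a list \<Rightarrow> 'a list" where
  "low n h [] = []"
| "low n h (b # w) = (if level h b \<le> n then b # low n (raise h b) w else low n (raise h b) w)"

lemma low_append: "low n h (u @ v) = low n h u @ low n (foldl raise h u) v"
  by (induction u arbitrary: h) auto

lemma level_raise: "(a, b) \<in> I \<Longrightarrow> level (raise h a) b = level h b"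
  unfolding level_def raise_def by (intro arg_cong[where f = Suc] arg_cong[where f = Max] image_cong) auto

lemma raise_commute: "(a, b) \<in> I \<Longrightarrow> raise (raise h a) b = raise (raise h b) a"
proof -
  assume ab: "(a, b) \<in> I"
  then have "a \<noteq> b" using I_irrefl by auto
  then show ?thesis using level_raise[OF ab, of h] level_raise[OF I_sym[OF ab], of h]
    by (simp add: raise_def fun_upd_twist)
qed

lemma low_heq: "heq I u v \<Longrightarrow> heq I (low n h u) (low n h v)"
proof (induction rule: heq_induct)
  case (swap x y a b)
  then show ?case
    using heq_swap[OF swap, of "low n h x" "low n (raise (raise (foldl raise h x) a) b) y"]
    by (simp add: low_append level_raise I_sym raise_commute)
qed (simp, erule heq_sym, erule (1) heq_trans)

lemma low_hle: "hle I u v \<Longrightarrow> hle I (low n h u) (low n h v)"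
  unfolding hle_def using low_heq[of "u @ _" v n h] by (auto simp: low_append)

lemma clist_props: "distinct (clist c)" "set (clist c) = (c :: 'a set)"
proof -
  have "\<exists>w. distinct w \<and> set w = c" using finite_distinct_list[of c] by auto
  from someI_ex[OF this] show "distinct (clist c)" "set (clist c) = c" unfolding clist_def by auto
qed

lemma clist_empty [simp]: "clist ({} :: 'a set) = []"
  using clist_props(2)[of "{}"] by simp

text \<open>The pieces of a clique do not see one another: each height is computed from the state
  before the clique.\<close>

lemma clique_word:
  assumes "distinct l" "clique I (set l)"
  shows "foldl raise h l = (\<lambda>b. if b \<in> set l then level h b else h b)"
    and "low n h l = filter (\<lambda>b. level h b \<le> n) l"
proof -
  have "foldl raise h l = (\<lambda>b. if b \<in> set l then level h b else h b) \<and>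
    low n h l = filter (\<lambda>b. level h b \<le> n) l"
    using assms
  proof (induction l arbitrary: h)
    case (Cons a l)
    have ind: "level (raise h a) b = level h b" if "b \<in> set l" for b
      using Cons.prems that by (intro level_raise) (auto simp: clique_def)
    have "clique I (set l)" using Cons.prems by (auto simp: clique_def)
    with Cons.IH[of "raise h a"] Cons.prems(1)
    have IH: "foldl raise (raise h a) l = (\<lambda>b. if b \<in> set l then level (raise h a) b else raise h a b)"
      "low n (raise h a) l = filter (\<lambda>b. level (raise h a) b \<le> n) l" by auto
    have "filter (\<lambda>b. level (raise h a) b \<le> n) l = filter (\<lambda>b. level h b \<le> n) l"
      using ind by (intro filter_cong) auto
    moreover have "(\<lambda>b. if b \<in> set l then level (raise h a) b else raise h a b) =
      (\<lambda>b. if b \<in> set (a # l) then level h b else h b)"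
      using ind by (auto simp: fun_eq_iff raise_def)
    ultimately show ?case using IH by simp
  qed simp
  then show "foldl raise h l = (\<lambda>b. if b \<in> set l then level h b else h b)"
    and "low n h l = filter (\<lambda>b. level h b \<le> n) l" by blast+
qed

text \<open>Makes the arbitrary enumeration chosen by \<open>clist\<close> immaterial up to
  \<open>heq\<close>.\<close>

lemma clique_words_heq:
  assumes "distinct u" "distinct v" "set u = set v" "clique I (set u)"
  shows "heq I u v"
  using assms
proof (induction u arbitrary: v)
  case (Cons a u)
  then obtain v1 v2 where v: "v = v1 @ a # v2" by (metis list.set_intros(1) split_list)
  have "clique I (set u)" using Cons.prems(4) by (auto simp: clique_def)
  moreover have "set u = set (v1 @ v2)" using Cons.prems v by auto
  ultimately have "heq I u (v1 @ v2)" using Cons v by auto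
  then have "heq I (a # u) (a # v1 @ v2)" by (rule heq_Cons)
  also have "heq I \<dots> v" unfolding v
    using Cons.prems v by (intro heq_commute_word) (auto simp: clique_def)
  finally show ?case .
qed simp

section \<open>Layer words and uniqueness of the Cartier-Foata form\<close>

lemma pword_0 [simp]: "pword g 0 = []"
  by (simp add: pword_def)

lemma pword_Suc: "pword g (Suc n) = pword g n @ clist (g n)"
  by (simp add: pword_def)

lemma pword_split: "i \<le> n \<Longrightarrow> pword g n = pword g i @ concat (map (\<lambda>j. clist (g j)) [i..<n])"
  unfolding pword_def by (metis concat_append map_append le_add_diff_inverse plus_nat.add_0 upt_add_eq_append zero_le)

lemma pword_hle: "i \<le> n \<Longrightarrow> hle I (pword g i) (pword g n)"
  by (subst pword_split[of i n g]) auto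

lemma pword_cong: "(\<And>i. i < n \<Longrightarrow> g i = g' i) \<Longrightarrow> pword g n = pword g' n"
  unfolding pword_def by (intro arg_cong[where f = concat] map_cong) auto

lemma length_pword_le: "length (pword g n) \<le> n * CARD('a)" for g :: "'a cfseq"
proof (induction n)
  case (Suc n)
  have "length (clist (g n)) = card (g n)" using clist_props[of "g n"] distinct_card by metis
  also have "\<dots> \<le> CARD('a)" by (intro card_mono) auto
  finally show ?case using Suc by (simp add: pword_Suc)
qed simp

lemma MbarD: "g \<in> Mbar I \<Longrightarrow> clique I (g n)" "g \<in> Mbar I \<Longrightarrow> carrow I (g n) (g (Suc n))"
  unfolding Mbar_def by auto

lemma fheaps_Mbar: "x \<in> fheaps I \<Longrightarrow> x \<in> Mbar I"
  and bdry_Mbar: "x \<in> bdry I \<Longrightarrow> x \<in> Mbar I"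
  unfolding fheaps_def bdry_def by auto

lemma Mbar_cases: "g \<in> Mbar I \<Longrightarrow> g \<in> fheaps I \<longleftrightarrow> g \<notin> bdry I"
  unfolding fheaps_def bdry_def by auto

text \<open>Height 0 means that no piece is present, so layer \<open>m\<close>, counted from 0, has
  height \<open>Suc m\<close>. By \<open>carrow\<close>, each of its pieces rests on a piece of the
  layer just below, and nothing earlier is higher than \<open>m\<close>.\<close>

lemma pword_heights:
  assumes "g \<in> Mbar I"
  shows "foldl raise (\<lambda>_. 0) (pword g m) b \<le> m"
    and "b \<in> g m \<Longrightarrow> level (foldl raise (\<lambda>_. 0) (pword g m)) b = Suc m"
proof -
  let ?h = "\<lambda>m. foldl raise (\<lambda>_. 0) (pword g m)"
  have level: "level (?h m) b = Suc m"
    if h: "\<forall>b. ?h m b \<le> m" "0 < m \<longrightarrow> (\<forall>b\<in>g (m - 1). ?h m b = m)" and b: "b \<in> g m" for m b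
  proof -
    have "\<exists>c. (c, b) \<notin> I \<and> ?h m c = m"
    proof (cases m)
      case 0
      then show ?thesis using h(1) I_irrefl by (intro exI[of _ b]) auto
    next
      case (Suc k)
      then obtain c where "c \<in> g k" "(c, b) \<notin> I"
        using MbarD(2)[OF assms, of k] b unfolding carrow_def by auto
      then show ?thesis using h(2) Suc by auto
    qed
    then have "Max (?h m ` {c. (c, b) \<notin> I}) = m"
      using h(1) by (intro Max_eqI) force+
    then show ?thesis by (simp add: level_def)
  qed
  have inv: "(\<forall>b. ?h m b \<le> m) \<and> (0 < m \<longrightarrow> (\<forall>b\<in>g (m - 1). ?h m b = m))" for m
  proof (induction m)
    case (Suc m)
    have "?h (Suc m) = (\<lambda>b. if b \<in> g m then level (?h m) b else ?h m b)"
      using clique_word(1)[of "clist (g m)" "?h m"] clist_props[of "g m"] MbarD(1)[OF assms, of m]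
      by (simp add: pword_Suc)
    then show ?case using level[of m] Suc by (auto simp: le_SucI)
  qed simp
  show "?h m b \<le> m" using inv by blast
  show "level (?h m) b = Suc m" if "b \<in> g m" using level inv that by blast
qed

lemma low_pword:
  assumes "g \<in> Mbar I" shows "low n (\<lambda>_. 0) (pword g m) = pword g (min n m)"
proof (induction m)
  case (Suc m)
  let ?h = "foldl raise (\<lambda>_. 0) (pword g m)"
  have "low n ?h (clist (g m)) = filter (\<lambda>b. level ?h b \<le> n) (clist (g m))"
    using clist_props[of "g m"] MbarD(1)[OF assms, of m] by (intro clique_word) auto
  also have "\<dots> = filter (\<lambda>b. Suc m \<le> n) (clist (g m))"
    using pword_heights(2)[OF assms] clist_props(2)[of "g m"] by (intro filter_cong) auto
  finally show ?case using Suc by (auto simp: pword_Suc low_append min_def le_Suc_eq)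
qed simp

text \<open>Truncating both sides at height \<open>n\<close> turns a comparison at unequal depths
  into one at depth \<open>n\<close>. This links the layerwise order \<open>mle\<close> with
  inclusion of ideals.\<close>

lemma pword_hle_level:
  assumes "g \<in> Mbar I" "g' \<in> Mbar I" "hle I (pword g n) (pword g' m)"
  shows "hle I (pword g n) (pword g' n)"
proof -
  have "hle I (pword g n) (pword g' (min n m))"
    using low_hle[OF assms(3), of n "\<lambda>_. 0"] low_pword[OF assms(1)] low_pword[OF assms(2)] by simp
  then show ?thesis using pword_hle[of "min n m" n g'] hle_trans by auto
qed

text \<open>Truncation makes the words agree after \<open>i\<close> and after \<open>Suc i\<close>
  layers; cancelling the former isolates layer \<open>i\<close>.\<close>

lemma pword_heq_layers:
  assumes "g \<in> Mbar I" "g' \<in> Mbar I" "heq I (pword g n) (pword g' n)" "i < n"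
  shows "g i = g' i"
proof -
  have *: "heq I (pword g j) (pword g' j)" if "j \<le> n" for j
    using low_heq[OF assms(3), of j "\<lambda>_. 0"] low_pword[OF assms(1)] low_pword[OF assms(2)] that by simp
  have "heq I (pword g i @ clist (g i)) (pword g' i @ clist (g' i))"
    using *[of "Suc i"] assms(4) by (simp add: pword_Suc)
  also have "heq I \<dots> (pword g i @ clist (g' i))"
    using *[of i] assms(4) by (intro heq_append heq_sym[of I "pword g i"]) auto
  finally have "heq I (clist (g i)) (clist (g' i))" by (rule heq_cancel_left)
  then show ?thesis using heq_set clist_props(2) by blast
qed

lemma Mbar_empty_mono:
  assumes "g \<in> Mbar I" "g n = {}" "n \<le> m" shows "g m = {}"
  using assms(3)
proof (induction m rule: dec_induct)
  case (step m)
  then show ?case using MbarD(2)[OF assms(1), of m] by (auto simp: carrow_def)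
qed (rule assms(2))

lemma pword_stable:
  assumes "g \<in> Mbar I" "g n = {}" "n \<le> m" shows "pword g m = pword g n"
  using assms(3)
proof (induction m rule: dec_induct)
  case (step m)
  then show ?case using Mbar_empty_mono[OF assms(1,2), of m] by (simp add: pword_Suc)
qed simp

lemma fword_eq_pword:
  assumes "g \<in> Mbar I" "g n = {}" shows "fword g = pword g n"
proof -
  have "g (LEAST n. g n = {}) = {}" using assms(2) by (rule LeastI)
  moreover have "(LEAST n. g n = {}) \<le> n" using assms(2) by (rule Least_le)
  ultimately show ?thesis unfolding fword_def using pword_stable[OF assms(1)] by metis
qed

lemma fheapE:
  assumes "x \<in> fheaps I"
  obtains N where "\<And>n. n \<ge> N \<Longrightarrow> x n = {} \<and> pword x n = fword x"
proof -
  obtain N where "x \<in> Mbar I" "x N = {}" using assms unfolding fheaps_def by auto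
  then show ?thesis using fword_eq_pword Mbar_empty_mono by (intro that[of N]) metis
qed

lemma fheap_eqI:
  assumes "x \<in> fheaps I" "y \<in> fheaps I" "heq I (fword x) (fword y)"
  shows "x = y"
proof
  fix i
  obtain N M where "\<And>n. n \<ge> N \<Longrightarrow> pword x n = fword x" "\<And>n. n \<ge> M \<Longrightarrow> pword y n = fword y"
    using fheapE[OF assms(1)] fheapE[OF assms(2)] by metis
  then have "heq I (pword x (max (Suc i) (max N M))) (pword y (max (Suc i) (max N M)))"
    using assms(3) by simp
  then show "x i = y i" by (rule pword_heq_layers[rotated 2]) (use assms fheaps_Mbar in auto)
qed

lemma hzero_fheap: "hzero \<in> fheaps I" "fword (hzero :: 'a cfseq) = []"
proof -
  show "hzero \<in> fheaps I" by (auto simp: fheaps_def Mbar_def hzero_def clique_def carrow_def)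
  then show "fword (hzero :: 'a cfseq) = []"
    using fword_eq_pword[of hzero 0] fheaps_Mbar by (simp add: hzero_def)
qed

text \<open>A new piece \<open>b\<close> falls through the layers as long as nothing obstructs it
  and is added to the one where it comes to rest.\<close>

lemma normal_form: "\<exists>g\<in>fheaps I. heq I w (fword g)"
proof (induction w rule: rev_induct)
  case Nil
  show ?case using hzero_fheap heq_refl[of I "[]"] by metis
next
  case (snoc b w)
  then obtain g where g: "g \<in> fheaps I" "heq I w (fword g)" by blast
  then obtain N where N: "\<And>n. n \<ge> N \<Longrightarrow> g n = {} \<and> pword g n = fword g" using fheapE by blast
  have M: "g \<in> Mbar I" using g fheaps_Mbar by blast
  define free where "free i \<longleftrightarrow> (\<forall>j\<ge>i. \<forall>c\<in>g j. (c, b) \<in> I)" for i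
  define i where "i = (LEAST i. free i)"
  have "free N" using N unfolding free_def by auto
  then have i: "free i" "\<And>j. j < i \<Longrightarrow> \<not> free j"
    unfolding i_def by (rule LeastI, use not_less_Least in blast)
  define g' where "g' = g(i := insert b (g i))"
  have clique: "clique I (g' n)" for n
    using MbarD(1)[OF M, of n] i(1) I_sym unfolding g'_def free_def clique_def by auto
  have arrow: "carrow I (g' n) (g' (Suc n))" for n
  proof (cases "Suc n = i")
    case True
    \<comment> \<open>Minimality of \<open>i\<close> supplies the piece supporting \<open>b\<close>:
      layer \<open>n\<close>, just below \<open>i\<close>, must contain a letter dependent on
      \<open>b\<close>.\<close>
    then have "\<not> free n" using i(2) by auto
    then obtain j c where j: "j \<ge> n" "c \<in> g j" "(c, b) \<notin> I" unfolding free_def by blast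
    then have "j = n" using i(1) True unfolding free_def by (metis le_antisym not_less_eq_eq)
    then show ?thesis using j MbarD(2)[OF M, of n] True unfolding g'_def carrow_def by auto
  next
    case False
    then show ?thesis using MbarD(2)[OF M, of n] unfolding g'_def carrow_def by fastforce
  qed
  define K where "K = Suc (max N i)"
  have K: "g' K = {}" using N[of K] unfolding g'_def K_def by auto
  have M': "g' \<in> Mbar I" using clique arrow unfolding Mbar_def by blast
  then have fin: "g' \<in> fheaps I" using K unfolding fheaps_def by blast
  define R where "R = concat (map (\<lambda>j. clist (g j)) [Suc i..<K])"
  have R_g: "pword g K = pword g i @ clist (g i) @ R"
    using pword_split[of "Suc i" K g] unfolding K_def R_def by (simp add: pword_Suc)
  have "pword g' i = pword g i" unfolding g'_def by (rule pword_cong) auto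
  moreover have "map (\<lambda>j. clist (g' j)) [Suc i..<K] = map (\<lambda>j. clist (g j)) [Suc i..<K]"
    unfolding g'_def by (intro map_cong) auto
  moreover have "g' i = insert b (g i)" by (simp add: g'_def)
  moreover have "Suc i \<le> K" by (simp add: K_def)
  ultimately have R_g': "pword g' K = pword g i @ clist (insert b (g i)) @ R"
    using pword_split[of "Suc i" K g'] unfolding R_def by (simp only: pword_Suc append_assoc)
  have "b \<notin> g i" using i(1) I_irrefl unfolding free_def by blast
  then have "heq I (clist (insert b (g i))) (clist (g i) @ [b])"
    using clique[of i] clist_props[of "g i"] clist_props[of "insert b (g i)"]
    by (intro clique_words_heq) (auto simp: g'_def)
  moreover have "(b, c) \<in> I" if c: "c \<in> set R" for c
  proof -
    obtain j where "Suc i \<le> j" "c \<in> g j" using c unfolding R_def by (auto simp: clist_props)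
    then show ?thesis using i(1) I_sym unfolding free_def by (meson Suc_leD)
  qed
  then have "heq I ([b] @ R) (R @ [b])" using heq_commute_word[of R b I "[]"] by simp
  ultimately have "heq I (clist (insert b (g i)) @ R) (clist (g i) @ R @ [b])"
    using heq_append[OF _ heq_refl[of I R]] heq_append[OF heq_refl[of I "clist (g i)"]] heq_trans
    by (metis (no_types) append.assoc)
  then have "heq I (fword g') (pword g K @ [b])"
    using fword_eq_pword[OF M' K] unfolding R_g R_g' by (simp add: heq_append)
  moreover have "heq I (w @ [b]) (pword g K @ [b])"
    using N[of K] g(2) unfolding K_def by (intro heq_append) auto
  ultimately have "heq I (w @ [b]) (fword g')" using heq_sym heq_trans by blast
  then show ?case using fin by blast
qed

lemma heap_of_fheaps: "heap_of I w \<in> fheaps I"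
  and heap_of_heq: "heq I w (fword (heap_of I w))"
proof -
  have "\<exists>!g. g \<in> fheaps I \<and> heq I w (fword g)"
    using normal_form[of w] fheap_eqI by (metis heq_sym heq_trans)
  from theI'[OF this] show "heap_of I w \<in> fheaps I" "heq I w (fword (heap_of I w))"
    unfolding heap_of_def by auto
qed

lemma heap_of_eqI: "x \<in> fheaps I \<Longrightarrow> heq I w (fword x) \<Longrightarrow> heap_of I w = x"
  using fheap_eqI[OF heap_of_fheaps] heap_of_heq by (metis heq_sym heq_trans)

lemma heap_of_cong: "heq I u v \<Longrightarrow> heap_of I u = heap_of I v"
  using heap_of_eqI[OF heap_of_fheaps] heap_of_heq heq_trans by metis

lemma hcat_fheaps: "hcat I x y \<in> fheaps I"
  and hcat_heq: "heq I (fword x @ fword y) (fword (hcat I x y))"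
  unfolding hcat_def by (rule heap_of_fheaps, rule heap_of_heq)

lemma hcat_heap_of: "hcat I (heap_of I u) (heap_of I v) = heap_of I (u @ v)"
  unfolding hcat_def by (rule heap_of_cong) (intro heq_append heq_sym[OF heap_of_heq])

lemma heap_of_fword: "x \<in> fheaps I \<Longrightarrow> heap_of I (fword x) = x"
  by (rule heap_of_eqI) auto

subsection \<open>Infinite heaps as ideals of finite heaps\<close>

text \<open>A common description of finite and infinite heaps under which order is inclusion and
  suprema of increasing sequences are unions. Using words instead of normal forms lets cancellation
  apply directly.\<close>

definition below :: "'a cfseq \<Rightarrow> 'a list set" where
  "below g = {u. \<exists>n. hle I u (pword g n)}"

lemma below_fheap: "x \<in> fheaps I \<Longrightarrow> below x = {u. hle I u (fword x)}"
proof (rule antisym)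
  assume x: "x \<in> fheaps I"
  obtain N where N: "\<And>n. n \<ge> N \<Longrightarrow> pword x n = fword x" using fheapE[OF x] by metis
  have "hle I (pword x n) (fword x)" for n using pword_hle[of n "max n N" x] N[of "max n N"] by auto
  then show "below x \<subseteq> {u. hle I u (fword x)}" unfolding below_def using hle_trans by blast
  show "{u. hle I u (fword x)} \<subseteq> below x" unfolding below_def using N[of N] by (auto intro: exI[of _ N])
qed

lemma mle_iff_below:
  assumes "g \<in> Mbar I" "g' \<in> Mbar I" shows "mle I g g' \<longleftrightarrow> below g \<subseteq> below g'"
proof
  assume "mle I g g'"
  then show "below g \<subseteq> below g'" unfolding mle_def below_def using hle_trans by blast
next
  assume b: "below g \<subseteq> below g'"
  have "\<exists>m. hle I (pword g n) (pword g' m)" for n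
    using b hle_refl[of I "pword g n"] unfolding below_def by blast
  then show "mle I g g'" unfolding mle_def using pword_hle_level[OF assms] by blast
qed

lemma mle_fheap_iff:
  assumes "x \<in> fheaps I" "g \<in> Mbar I" shows "mle I x g \<longleftrightarrow> fword x \<in> below g"
proof -
  have "{u. hle I u (fword x)} \<subseteq> below g \<longleftrightarrow> fword x \<in> below g"
    unfolding below_def using hle_refl hle_trans by blast
  then show ?thesis using mle_iff_below[of x g] below_fheap[OF assms(1)] assms fheaps_Mbar by simp
qed

lemma Mbar_eqI:
  assumes "g \<in> Mbar I" "g' \<in> Mbar I" "below g = below g'" shows "g = g'"
proof
  fix i
  have "hle I (pword g n) (pword g' n)" "hle I (pword g' n) (pword g n)" for n
    using assms mle_iff_below[of g g'] mle_iff_below[of g' g] unfolding mle_def by auto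
  then have "heq I (pword g n) (pword g' n)" for n
    using hle_length_imp_heq hle_length by metis
  then show "g i = g' i" using pword_heq_layers[OF assms(1,2)] by blast
qed

lemma Lub_eqI:
  assumes "z \<in> Mbar I" "S \<subseteq> Mbar I" "below z = (\<Union>s\<in>S. below s)"
  shows "Lub I S = z"
  unfolding Lub_def
proof (rule the_equality)
  show lub: "is_lub I S z" unfolding is_lub_def
    using assms mle_iff_below by (auto simp: subset_iff)
  show "z' = z" if "is_lub I S z'" for z'
    using lub that assms(1) mle_iff_below[of z z'] mle_iff_below[of z' z] unfolding is_lub_def
    by (intro Mbar_eqI) auto
qed

lemma bounded_mono_nat_stable:
  fixes f :: "nat \<Rightarrow> nat"
  assumes "mono f" "\<And>n. f n \<le> B" shows "\<exists>N. \<forall>n\<ge>N. f n = f N"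
proof -
  have "finite (range f)" using assms(2) by (intro finite_subset[OF _ finite_atMost[of B]] subsetI) auto
  then have "Max (range f) \<in> range f" by (rule Max_in) simp
  then obtain N where N: "f N = Max (range f)" by (metis imageE)
  have "f n = f N" if "n \<ge> N" for n
    using monoD[OF assms(1) that] Max_ge[OF \<open>finite (range f)\<close>, of "f n"] N by simp
  then show ?thesis by blast
qed

text \<open>For fixed \<open>k\<close> the first \<open>k\<close> layers increase and have at most
  \<open>k * CARD('a)\<close> pieces, so they are eventually constant; the limit is read off layer
  by layer.\<close>

lemma increasing_sequence_has_limit:
  assumes xs: "\<And>n. xs n \<in> fheaps I" and mono: "\<And>n. hle I (fword (xs n)) (fword (xs (Suc n)))"
  shows "\<exists>z\<in>Mbar I. below z = (\<Union>n. below (xs n))"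
proof -
  have M: "xs n \<in> Mbar I" for n using xs fheaps_Mbar by blast
  have mono': "hle I (fword (xs n)) (fword (xs m))" if "n \<le> m" for n m
    using that by (induction m rule: dec_induct) (auto intro: hle_trans mono)
  have pmono: "hle I (pword (xs n) k) (pword (xs m) k)" if "n \<le> m" for n m k
  proof -
    have "pword (xs n) k \<in> below (xs n)" unfolding below_def by (auto intro: exI[of _ k])
    then have "hle I (pword (xs n) k) (fword (xs m))"
      using below_fheap[OF xs] mono'[OF that] hle_trans by blast
    then obtain K where "hle I (pword (xs n) k) (pword (xs m) K)"
      using fheapE[OF xs[of m]] by (metis order_refl)
    then show ?thesis by (rule pword_hle_level[OF M M])
  qed
  have "\<exists>N. \<forall>n\<ge>N. \<forall>i<k. xs n i = xs N i" for k
  proof -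
    have "mono (\<lambda>n. length (pword (xs n) k))"
      using pmono hle_length by (intro monoI) blast
    with bounded_mono_nat_stable length_pword_le[of _ k]
    obtain N where N: "\<forall>n\<ge>N. length (pword (xs n) k) = length (pword (xs N) k)" by blast
    have "xs n i = xs N i" if "n \<ge> N" "i < k" for n i
    proof -
      have "heq I (pword (xs N) k) (pword (xs n) k)"
        using N[rule_format, OF that(1)] by (intro hle_length_imp_heq pmono[OF that(1)]) simp
      then show ?thesis using pword_heq_layers[OF M M] that by metis
    qed
    then show ?thesis by blast
  qed
  then obtain N where N: "\<And>k n i. n \<ge> N k \<Longrightarrow> i < k \<Longrightarrow> xs n i = xs (N k) i" by metis
  define z where "z i = xs (N (Suc i)) i" for i
  have z: "z i = xs n i" if "n \<ge> N k" "i < k" for n i k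
  proof -
    let ?m = "max n (N (Suc i))"
    have "xs ?m i = xs (N (Suc i)) i" "xs ?m i = xs (N k) i" "xs n i = xs (N k) i"
      using N[of "Suc i" ?m i] N[of k ?m i] N[of k n i] that by auto
    then show ?thesis by (simp add: z_def)
  qed
  have "z \<in> Mbar I" unfolding Mbar_def
  proof (intro CollectI allI)
    fix i
    have "z i = xs (N (Suc (Suc i))) i" "z (Suc i) = xs (N (Suc (Suc i))) (Suc i)"
      by (rule z[of "Suc (Suc i)"]; simp)+
    then show "clique I (z i) \<and> carrow I (z i) (z (Suc i))" using MbarD[OF M] by simp
  qed
  moreover have pz: "pword z k = pword (xs n) k" if "n \<ge> N k" for n k
    using z that by (intro pword_cong) auto
  have "below z = (\<Union>n. below (xs n))"
  proof (intro equalityI subsetI)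
    fix u assume "u \<in> below z"
    then obtain k where "hle I u (pword z k)" unfolding below_def by blast
    then have "hle I u (pword (xs (N k)) k)" using pz[of k "N k"] by simp
    then show "u \<in> (\<Union>n. below (xs n))" unfolding below_def by blast
  next
    fix u assume "u \<in> (\<Union>n. below (xs n))"
    then obtain n k where "hle I u (pword (xs n) k)" unfolding below_def by blast
    also have "hle I \<dots> (pword (xs (max n (N k))) k)" by (rule pmono) simp
    also have "\<dots> = pword z k" by (rule pz[symmetric]) simp
    finally show "u \<in> below z" unfolding below_def by blast
  qed
  ultimately show ?thesis by blast
qed

lemma Lub_increasing:
  assumes "\<And>n. xs n \<in> fheaps I" "\<And>n. hle I (fword (xs n)) (fword (xs (Suc n)))"
  shows "Lub I (range xs) \<in> Mbar I" "below (Lub I (range xs)) = (\<Union>n. below (xs n))"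
proof -
  obtain z where z: "z \<in> Mbar I" "below z = (\<Union>n. below (xs n))"
    using increasing_sequence_has_limit assms by blast
  then have "Lub I (range xs) = z" using assms(1) fheaps_Mbar by (intro Lub_eqI) auto
  then show "Lub I (range xs) \<in> Mbar I" "below (Lub I (range xs)) = (\<Union>n. below (xs n))"
    using z by auto
qed

section \<open>Left multiplication by a finite heap and its inverse\<close>

lemma trunc_props:
  assumes "g \<in> Mbar I" shows "trunc g n \<in> fheaps I" "fword (trunc g n) = pword g n"
proof -
  have "trunc g n \<in> Mbar I" unfolding Mbar_def
    using MbarD[OF assms] by (auto simp: trunc_def clique_def carrow_def)
  moreover have "trunc g n n = {}" by (simp add: trunc_def)
  ultimately show "trunc g n \<in> fheaps I" "fword (trunc g n) = pword g n"
    using fword_eq_pword[of "trunc g n" n] pword_cong[of n "trunc g n" g]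
    by (auto simp: fheaps_def trunc_def)
qed

lemma hmult_props:
  assumes "g \<in> Mbar I"
  shows "hmult I x g \<in> Mbar I" "below (hmult I x g) = {u. \<exists>n. hle I u (fword x @ pword g n)}"
proof -
  let ?xs = "\<lambda>n. hcat I x (trunc g n)"
  have eq: "heq I (fword x @ pword g n) (fword (?xs n))" for n
    using hcat_heq[of x "trunc g n"] trunc_props[OF assms] by simp
  have fh: "?xs n \<in> fheaps I" for n by (rule hcat_fheaps)
  have "hle I (fword (?xs n)) (fword (?xs (Suc n)))" for n
  proof -
    have "hle I (fword x @ pword g n) (fword x @ pword g (Suc n))"
      by (intro hle_append_left pword_hle) simp
    then show ?thesis using eq heq_hle_trans hle_heq_trans heq_sym by blast
  qed
  note L = Lub_increasing[of ?xs, OF fh this]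
  show "hmult I x g \<in> Mbar I" unfolding hmult_def by (rule L)
  have "below (?xs n) = {u. hle I u (fword x @ pword g n)}" for n
    unfolding below_fheap[OF fh] using eq[of n] heq_sym hle_heq_trans by blast
  then show "below (hmult I x g) = {u. \<exists>n. hle I u (fword x @ pword g n)}"
    using L(2) unfolding hmult_def by auto
qed

lemma hmult_fheap:
  assumes "y \<in> fheaps I" shows "hmult I x y = hcat I x y"
proof (rule Mbar_eqI)
  have y: "y \<in> Mbar I" using assms fheaps_Mbar by blast
  show "hmult I x y \<in> Mbar I" by (rule hmult_props[OF y])
  show "hcat I x y \<in> Mbar I" using hcat_fheaps fheaps_Mbar by blast
  have "(\<exists>n. hle I u (fword x @ pword y n)) \<longleftrightarrow> hle I u (fword x @ fword y)" for u
  proof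
    assume "\<exists>n. hle I u (fword x @ pword y n)"
    then obtain n where n: "hle I u (fword x @ pword y n)" by blast
    have "pword y n \<in> below y" unfolding below_def by (auto intro: exI[of _ n])
    then have "hle I (fword x @ pword y n) (fword x @ fword y)"
      using below_fheap[OF assms] hle_append_left by blast
    with n show "hle I u (fword x @ fword y)" by (rule hle_trans)
  next
    assume "hle I u (fword x @ fword y)"
    then show "\<exists>n. hle I u (fword x @ pword y n)" using fheapE[OF assms] by (metis order_refl)
  qed
  then show "below (hmult I x y) = below (hcat I x y)"
    unfolding hmult_props(2)[OF y] below_fheap[OF hcat_fheaps]
    using hcat_heq[of x y] heq_sym hle_heq_trans by blast
qed

lemma length_pword_bdry: "g \<in> bdry I \<Longrightarrow> n \<le> length (pword g n)"
proof (induction n)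
  case (Suc n)
  have "clist (g n) \<noteq> []" using Suc.prems clist_props(2)[of "g n"] unfolding bdry_def by force
  then have "1 \<le> length (clist (g n))" by (simp add: Suc_le_eq)
  then show ?case using Suc by (simp add: pword_Suc)
qed simp

lemma bdry_if_unbounded:
  assumes "z \<in> Mbar I" "\<And>n. \<exists>u\<in>below z. n \<le> length u" shows "z \<in> bdry I"
proof (rule ccontr)
  assume "z \<notin> bdry I"
  then have z: "z \<in> fheaps I" using assms(1) Mbar_cases by blast
  obtain u where "u \<in> below z" "Suc (length (fword z)) \<le> length u" using assms(2) by blast
  then show False using below_fheap[OF z] hle_length by fastforce
qed

text \<open>Existence: divide the long prefixes of \<open>g\<close> by \<open>x\<close>; by
  cancellation the quotients \<open>r n\<close> increase, and \<open>z\<close> is their limit.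
  Uniqueness is left cancellation again. This justifies the definite description in
  \<open>hminus\<close>.\<close>

lemma hmult_solvable:
  assumes "x \<in> fheaps I" "g \<in> bdry I" "mle I x g"
  shows "\<exists>!z. z \<in> bdry I \<and> hmult I x z = g"
proof (rule ex_ex1I)
  have gM: "g \<in> Mbar I" using assms(2) bdry_Mbar by blast
  obtain k where k: "hle I (fword x) (pword g k)"
    using mle_fheap_iff[OF assms(1) gM] assms(3) unfolding below_def by blast
  have "\<exists>r. heq I (fword x @ r) (pword g (k + n))" for n
    using hle_trans[OF k pword_hle[of k "k + n" g]] unfolding hle_def by auto
  then obtain r where r: "\<And>n. heq I (fword x @ r n) (pword g (k + n))" by metis
  define xs where "xs n = heap_of I (r n)" for n
  have fh: "xs n \<in> fheaps I" for n unfolding xs_def by (rule heap_of_fheaps)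
  have heq_r: "heq I (r n) (fword (xs n))" for n unfolding xs_def by (rule heap_of_heq)
  have hle_r: "hle I (r n) (r m)" if "n \<le> m" for n m
  proof -
    have "hle I (fword x @ r n) (pword g (k + m))"
      using that by (intro heq_hle_trans[OF r[of n]] pword_hle) simp
    then have "hle I (fword x @ r n) (fword x @ r m)" using r[of m] heq_sym hle_heq_trans by blast
    then show ?thesis by (rule hle_cancel_left)
  qed
  have "hle I (fword (xs n)) (fword (xs (Suc n)))" for n
    using hle_r[of n "Suc n"] heq_r heq_sym heq_hle_trans hle_heq_trans by (metis le_SucI order_refl)
  with increasing_sequence_has_limit[of xs, OF fh] obtain z where
    z: "z \<in> Mbar I" "below z = (\<Union>n. below (xs n))" by blast
  have bz: "u \<in> below z \<longleftrightarrow> (\<exists>n. hle I u (r n))" for u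
    unfolding z(2) below_fheap[OF fh] using heq_r heq_sym hle_heq_trans by blast
  have "z \<in> bdry I"
  proof (rule bdry_if_unbounded[OF z(1)])
    fix n
    have "k + (n + length (fword x)) \<le> length (fword x @ r (n + length (fword x)))"
      using heq_length[OF r] length_pword_bdry[OF assms(2)] by metis
    then have "n \<le> length (r (n + length (fword x)))" by simp
    then show "\<exists>u\<in>below z. n \<le> length u" using bz hle_refl by blast
  qed
  moreover have "hmult I x z = g"
  proof (rule Mbar_eqI[OF hmult_props(1)[OF z(1)] gM], unfold hmult_props(2)[OF z(1)],
      intro equalityI subsetI)
    fix u assume "u \<in> {u. \<exists>n. hle I u (fword x @ pword z n)}"
    then obtain n where n: "hle I u (fword x @ pword z n)" by blast
    have "pword z n \<in> below z" unfolding below_def by (auto intro: exI[of _ n])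
    then obtain m where "hle I (pword z n) (r m)" using bz by blast
    then have "hle I u (fword x @ r m)" using n hle_append_left hle_trans by blast
    then show "u \<in> below g" unfolding below_def using r hle_heq_trans by blast
  next
    fix u assume "u \<in> below g"
    then obtain n where "hle I u (pword g n)" unfolding below_def by blast
    also have "hle I \<dots> (pword g (k + n))" by (rule pword_hle) simp
    also have "hle I \<dots> (fword x @ r n)" using r[of n] heq_sym heq_imp_hle by blast
    finally have u: "hle I u (fword x @ r n)" .
    have "r n \<in> below z" using bz hle_refl by blast
    then obtain m where "hle I (r n) (pword z m)" unfolding below_def by blast
    then have "hle I u (fword x @ pword z m)" using u hle_append_left hle_trans by blast
    then show "u \<in> {u. \<exists>n. hle I u (fword x @ pword z n)}" by blast
  qed
  ultimately show "\<exists>z. z \<in> bdry I \<and> hmult I x z = g" by blast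
next
  fix z z' assume z: "z \<in> bdry I \<and> hmult I x z = g" "z' \<in> bdry I \<and> hmult I x z' = g"
  have sub: "below y \<subseteq> below y'" if y: "y \<in> bdry I" "y' \<in> bdry I" "hmult I x y = hmult I x y'" for y y'
  proof
    fix u assume "u \<in> below y"
    then obtain n where n: "hle I u (pword y n)" unfolding below_def by blast
    have "fword x @ u \<in> below (hmult I x y')"
      unfolding y(3)[symmetric] hmult_props(2)[OF bdry_Mbar[OF y(1)]] using hle_append_left[OF n] by blast
    then obtain m where "hle I (fword x @ u) (fword x @ pword y' m)"
      unfolding hmult_props(2)[OF bdry_Mbar[OF y(2)]] by blast
    then show "u \<in> below y'" unfolding below_def using hle_cancel_left by blast
  qed
  show "z = z'" using z sub[of z z'] sub[of z' z] by (intro Mbar_eqI bdry_Mbar) auto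
qed

lemma hminus_props:
  assumes "x \<in> fheaps I" "g \<in> bdry I" "mle I x g"
  shows "hminus I g x \<in> bdry I" "hmult I x (hminus I g x) = g"
  using theI'[OF hmult_solvable[OF assms]] unfolding hminus_def by auto

text \<open>Transports cylinders along \<open>hminus\<close>, so that applying V to the remainder of
  \<open>g\<close> can be expressed through cylinders of products.\<close>

lemma hcat_mle_iff:
  assumes "x \<in> fheaps I" "y \<in> fheaps I" "g \<in> bdry I" "mle I x g"
  shows "mle I (hcat I x y) g \<longleftrightarrow> mle I y (hminus I g x)"
proof -
  let ?z = "hminus I g x"
  have z: "?z \<in> Mbar I" "hmult I x ?z = g" using hminus_props[OF assms(1,3,4)] bdry_Mbar by auto
  have g: "g \<in> Mbar I" using assms bdry_Mbar by blast
  have "fword (hcat I x y) \<in> below g \<longleftrightarrow> fword x @ fword y \<in> below g"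
    unfolding below_def using hcat_heq[of x y] heq_hle_trans heq_sym by blast
  also have "\<dots> \<longleftrightarrow> (\<exists>n. hle I (fword x @ fword y) (fword x @ pword ?z n))"
    using hmult_props(2)[OF z(1), of x] z(2) by auto
  also have "\<dots> \<longleftrightarrow> fword y \<in> below ?z"
    unfolding below_def using hle_cancel_left hle_append_left by blast
  finally show ?thesis
    using mle_fheap_iff[OF hcat_fheaps g] mle_fheap_iff[OF assms(2) z(1)] by simp
qed

end

subsection \<open>Bounded finite sums\<close>

text \<open>Bounds on finite subsums combine without summability side conditions; for nonnegative
  terms they yield summability when needed.\<close>

definition sums_bounded :: "('b \<Rightarrow> real) \<Rightarrow> 'b set \<Rightarrow> real \<Rightarrow> bool" where
  "sums_bounded g A M \<longleftrightarrow> (\<forall>F. finite F \<and> F \<subseteq> A \<longrightarrow> sum g F \<le> M)"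

lemma sums_boundedI: "(\<And>F. finite F \<Longrightarrow> F \<subseteq> A \<Longrightarrow> sum g F \<le> M) \<Longrightarrow> sums_bounded g A M"
  and sums_boundedD: "sums_bounded g A M \<Longrightarrow> finite F \<Longrightarrow> F \<subseteq> A \<Longrightarrow> sum g F \<le> M"
  by (auto simp: sums_bounded_def)

lemma sums_bounded_nonneg: "sums_bounded g A M \<Longrightarrow> 0 \<le> M"
  using sums_boundedD[of g A M "{}"] by simp

lemma sums_bounded_mono:
  assumes "sums_bounded g A M" "\<And>x. x \<in> B \<Longrightarrow> h x \<le> g x" "B \<subseteq> A" "M \<le> M'"
  shows "sums_bounded h B M'"
proof (rule sums_boundedI)
  fix F assume F: "finite F" "F \<subseteq> B"
  have "sum h F \<le> sum g F" using F assms(2) by (intro sum_mono) auto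
  also have "\<dots> \<le> M" using F assms(3) by (intro sums_boundedD[OF assms(1)]) auto
  finally show "sum h F \<le> M'" using assms(4) by simp
qed

lemma sums_bounded_summable:
  assumes "sums_bounded g A M" "\<And>x. x \<in> A \<Longrightarrow> 0 \<le> g x"
  shows "g summable_on A" "infsum g A \<le> M"
proof -
  show s: "g summable_on A"
    using assms by (intro nonneg_bdd_above_summable_on bdd_aboveI2[where M = M]) (auto intro: sums_boundedD)
  show "infsum g A \<le> M"
    using s by (rule infsum_le_finite_sums) (rule sums_boundedD[OF assms(1)])
qed

text \<open>Only existence of a factorization is required: choosing one for each element is
  injective, because \<open>m\<close> recovers the element.\<close>

lemma sums_bounded_product:
  assumes A: "sums_bounded g A a" and B: "sums_bounded g B b"
    and pos: "\<And>x. x \<in> A \<union> B \<Longrightarrow> 0 \<le> g x"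
    and fac: "\<And>x. x \<in> C \<Longrightarrow> \<exists>p\<in>A. \<exists>r\<in>B. x = m p r"
    and mult: "\<And>p r. p \<in> A \<Longrightarrow> r \<in> B \<Longrightarrow> g (m p r) = g p * g r"
  shows "sums_bounded g C (a * b)"
proof (rule sums_boundedI)
  fix F assume F: "finite F" "F \<subseteq> C"
  then have "\<forall>x\<in>F. \<exists>q. fst q \<in> A \<and> snd q \<in> B \<and> x = m (fst q) (snd q)" using fac by fastforce
  then obtain q where q: "\<And>x. x \<in> F \<Longrightarrow> fst (q x) \<in> A \<and> snd (q x) \<in> B \<and> x = m (fst (q x)) (snd (q x))"
    by metis
  let ?h = "\<lambda>(p, r). g p * g r" and ?A = "(fst \<circ> q) ` F" and ?B = "(snd \<circ> q) ` F"
  have sub: "?A \<subseteq> A" "?B \<subseteq> B" using q by auto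
  have "inj_on q F" using q by (metis inj_onI)
  have "sum g F = sum (?h \<circ> q) F"
    using q mult by (intro sum.cong) (auto simp: case_prod_beta, metis)
  also have "\<dots> = sum ?h (q ` F)" using \<open>inj_on q F\<close> by (simp add: sum.reindex)
  also have "\<dots> \<le> sum ?h (?A \<times> ?B)"
  proof (rule sum_mono2)
    show "q ` F \<subseteq> ?A \<times> ?B"
    proof
      fix y assume "y \<in> q ` F"
      then show "y \<in> ?A \<times> ?B" by (auto simp: mem_Times_iff)
    qed
    show "0 \<le> ?h y" if "y \<in> ?A \<times> ?B - q ` F" for y
    proof -
      have "fst y \<in> A" "snd y \<in> B" using that sub by (auto simp: mem_Times_iff)
      then show ?thesis using pos by (simp add: case_prod_beta)
    qed
  qed (use F in auto)
  also have "\<dots> = sum g ?A * sum g ?B" by (simp add: sum_product sum.cartesian_product)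
  also have "\<dots> \<le> a * b"
    using sub F sums_bounded_nonneg[OF A] pos
    by (intro mult_mono sums_boundedD[OF A] sums_boundedD[OF B] sum_nonneg) auto
  finally show "sum g F \<le> a * b" .
qed

lemma sums_bounded_fibers:
  fixes k :: "'b \<Rightarrow> nat"
  assumes "\<And>n. sums_bounded g {x \<in> A. k x = n} (s n)" "summable s"
  shows "sums_bounded g A (suminf s)"
proof (rule sums_boundedI)
  fix F assume F: "finite F" "F \<subseteq> A"
  have "sum g F = (\<Sum>n\<in>k ` F. sum g {x \<in> F. k x = n})" using F by (subst sum.group) auto
  also have "\<dots> \<le> (\<Sum>n\<in>k ` F. s n)"
    using F by (intro sum_mono sums_boundedD[OF assms(1)]) auto
  also have "\<dots> \<le> suminf s"
    using F sums_bounded_nonneg[OF assms(1)] by (intro sum_le_suminf assms(2)) auto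
  finally show "sum g F \<le> suminf s" .
qed

text \<open>Shifting by \<open>m\<close> shows that a partial sum S satisfies S \<le> (first
  \<open>m\<close> terms) + \<open>t m\<close> * S, which can be solved for S since
  \<open>t m < 1\<close>.\<close>

lemma submultiplicative_summable:
  fixes t :: "nat \<Rightarrow> real"
  assumes pos: "\<And>n. 0 \<le> t n" and sub: "\<And>n m. t (n + m) \<le> t n * t m" and m: "t m < 1"
  shows "summable t"
proof (rule summableI_nonneg_bounded[OF pos])
  fix N
  have "(\<Sum>i<N + m. t i) = (\<Sum>i<m. t i) + (\<Sum>i<N. t (i + m))"
    by (induction N) auto
  also have "\<dots> \<le> (\<Sum>i<m. t i) + (\<Sum>i<N. t i * t m)"
    by (intro add_left_mono sum_mono sub)
  also have "(\<Sum>i<N. t i * t m) \<le> (\<Sum>i<N + m. t i) * t m"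
    unfolding sum_distrib_right[symmetric] using pos by (intro mult_right_mono sum_mono2) auto
  finally have "(\<Sum>i<N + m. t i) * (1 - t m) \<le> (\<Sum>i<m. t i)" by (simp add: algebra_simps)
  then have "(\<Sum>i<N + m. t i) \<le> (\<Sum>i<m. t i) / (1 - t m)" using m by (simp add: pos_le_divide_eq)
  moreover have "(\<Sum>i<N. t i) \<le> (\<Sum>i<N + m. t i)" using pos by (intro sum_mono2) auto
  ultimately show "(\<Sum>i<N. t i) \<le> (\<Sum>i<m. t i) / (1 - t m)" by simp
qed

text \<open>Second-order Taylor expansion with a remainder coefficient that does not depend on
  \<open>t\<close>. The 2 in the exponent combines the Lagrange factor \<open>exp s\<close> with the
  exponential that dominates the square of \<open>y\<close>.\<close>

lemma exp_quadratic_bound: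
  fixes y t t0 :: real
  assumes "0 \<le> t" "t \<le> t0" "0 < t0"
  shows "exp (t * y) \<le> 1 + t * y + t\<^sup>2 * (2 / t0\<^sup>2 * exp (2 * t0 * \<bar>y\<bar>))"
proof -
  obtain s where s: "\<bar>s\<bar> \<le> \<bar>t * y\<bar>" "exp (t * y) = (\<Sum>m<2. (t * y) ^ m / fact m) + exp s / fact 2 * (t * y)\<^sup>2"
    using Maclaurin_exp_le[of "t * y" 2] by blast
  have "s \<le> t0 * \<bar>y\<bar>"
    using s(1) assms mult_right_mono[of t t0 "\<bar>y\<bar>"] by (simp add: abs_mult)
  then have es: "exp s \<le> exp (t0 * \<bar>y\<bar>)" by simp
  have "(t0 * \<bar>y\<bar>)\<^sup>2 / 2 \<le> exp (t0 * \<bar>y\<bar>)"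
    using exp_lower_Taylor_quadratic[of "t0 * \<bar>y\<bar>"] assms(3) mult_nonneg_nonneg[of t0 "\<bar>y\<bar>"] by linarith
  then have y2: "y\<^sup>2 \<le> 2 / t0\<^sup>2 * exp (t0 * \<bar>y\<bar>)"
    using assms(3) by (simp add: power_mult_distrib field_simps)
  have "exp (t * y) = 1 + t * y + t\<^sup>2 * (exp s / 2 * y\<^sup>2)"
    unfolding s(2) by (simp add: numeral_2_eq_2 power_mult_distrib)
  also have "exp s / 2 * y\<^sup>2 \<le> exp (t0 * \<bar>y\<bar>) * (2 / t0\<^sup>2 * exp (t0 * \<bar>y\<bar>))"
  proof (rule mult_mono[OF _ y2])
    show "exp s / 2 \<le> exp (t0 * \<bar>y\<bar>)" using es exp_gt_zero[of s] by linarith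
  qed auto
  also have "\<dots> = 2 / t0\<^sup>2 * exp (2 * t0 * \<bar>y\<bar>)"
    by (simp add: mult_exp_exp algebra_simps)
  finally show ?thesis by (simp add: mult_left_mono)
qed

subsection \<open>The valuation of a Bernoulli measure\<close>

locale bernoulli_heaps = heaps I for I :: "('a::finite \<times> 'a) set" +
  fixes P :: "'a cfseq measure"
  assumes bern: "bernoulli I P" and conn: "\<And>a b. (a, b) \<in> (- I)\<^sup>*"
begin

sublocale prob_space P using bern unfolding bernoulli_def by blast

definition val :: "'a cfseq \<Rightarrow> real" where
  "val x = measure P (up I x)"

lemma space_P: "space P = bdry I"
  using bern unfolding bernoulli_def by blast

lemma up_sets: "x \<in> fheaps I \<Longrightarrow> up I x \<in> sets P"
  using bern unfolding bernoulli_def by auto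

lemma val_pos: "x \<in> fheaps I \<Longrightarrow> 0 < val x"
  using bern unfolding bernoulli_def val_def by blast

lemma val_nonneg [simp]: "0 \<le> val x"
  by (simp add: val_def)

lemma val_hcat: "x \<in> fheaps I \<Longrightarrow> y \<in> fheaps I \<Longrightarrow> val (hcat I x y) = val x * val y"
  using bern unfolding bernoulli_def val_def by blast

lemma hsize_hcat: "hsize (hcat I x y) = hsize x + hsize y"
  using heq_length[OF hcat_heq[of x y]] by (simp add: hsize_def)

lemma mset_hcat: "mset (fword (hcat I x y)) = mset (fword x) + mset (fword y)"
  using heq_mset[OF hcat_heq[of x y]] by simp

lemma cost_mset: "cost \<phi> x = sum_mset (image_mset \<phi> (mset (fword x)))"
  by (simp add: cost_def sum_mset_sum_list flip: mset_map)

lemma cost_hcat: "cost \<phi> (hcat I x y) = cost \<phi> x + cost \<phi> y"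
  by (simp add: cost_mset mset_hcat)

lemma common_upper:
  assumes "g \<in> up I x" "g \<in> up I y" "x \<in> fheaps I" "y \<in> fheaps I"
  shows "\<exists>w. hle I (fword x) w \<and> hle I (fword y) w"
proof -
  have "g \<in> Mbar I" using assms(1) bdry_Mbar unfolding up_def by auto
  then obtain n m where "hle I (fword x) (pword g n)" "hle I (fword y) (pword g m)"
    using assms mle_fheap_iff unfolding up_def below_def by blast
  then have "hle I (fword x) (pword g (max n m))" "hle I (fword y) (pword g (max n m))"
    by (auto intro: hle_trans[OF _ pword_hle])
  then show ?thesis by blast
qed

lemma sum_val_disjoint:
  assumes "finite F" "F \<subseteq> fheaps I" "\<And>x y g. x \<in> F \<Longrightarrow> y \<in> F \<Longrightarrow> g \<in> up I x \<Longrightarrow> g \<in> up I y \<Longrightarrow> x = y"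
  shows "sum val F \<le> 1"
proof -
  have "sum val F = measure P (\<Union>x\<in>F. up I x)"
    unfolding val_def using assms up_sets
    by (intro finite_measure_finite_Union[symmetric]) (auto simp: disjoint_family_on_def)
  then show ?thesis by simp
qed

section \<open>Pyramids and heaps avoiding a letter\<close>

definition cnt :: "'a \<Rightarrow> 'a cfseq \<Rightarrow> nat" where
  "cnt a x = count (mset (fword x)) a"

definition pyramids :: "'a \<Rightarrow> 'a cfseq set" where
  "pyramids a = {x \<in> fheaps I. topped a (fword x) \<and> cnt a x = 1}"

definition free_heaps :: "'a \<Rightarrow> 'a cfseq set" where
  "free_heaps a = {x \<in> fheaps I. cnt a x = 0}"

lemma cnt_hcat: "cnt a (hcat I x y) = cnt a x + cnt a y"
  by (simp add: cnt_def mset_hcat)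

lemma mset_heap_of: "mset (fword (heap_of I w)) = mset w"
  using heq_mset[OF heap_of_heq[of w]] by simp

lemma topped_disjoint:
  assumes "x \<in> fheaps I" "y \<in> fheaps I" "topped a (fword x)" "topped a (fword y)" "cnt a x = cnt a y"
    "g \<in> up I x" "g \<in> up I y"
  shows "x = y"
  using common_upper[OF assms(6,7,1,2)] topped_unique[OF assms(3,4)] assms(5) fheap_eqI[OF assms(1,2)]
  unfolding cnt_def by blast

lemma pyramids_sum_le_1: "sums_bounded val (pyramids a) 1"
proof (rule sums_boundedI, rule sum_val_disjoint)
  fix F x y g assume F: "F \<subseteq> pyramids a" "x \<in> F" "y \<in> F" and g: "g \<in> up I x" "g \<in> up I y"
  have "x \<in> pyramids a" "y \<in> pyramids a" using F by auto
  then show "x = y" using g unfolding pyramids_def by (intro topped_disjoint[of x y a g]) auto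
qed (auto simp: pyramids_def)

text \<open>After appending \<open>W\<close> all heaps are topped and contain exactly the
  occurrences of \<open>a\<close> in \<open>W\<close>, so their cylinders are disjoint;
  multiplicativity charges only the constant factor \<open>val W\<close>.\<close>

lemma free_heaps_sum_bounded: "\<exists>M. sums_bounded val (free_heaps a) M"
proof -
  obtain w where w: "\<And>z. topped a (z @ w)" using covering_word[of a] conn by auto
  define W where "W = heap_of I w"
  have W: "W \<in> fheaps I" unfolding W_def by (rule heap_of_fheaps)
  have top: "topped a (fword (hcat I z W))" for z
  proof -
    have "heq I (fword z @ w) (fword z @ fword W)"
      unfolding W_def by (intro heq_append heap_of_heq) simp
    then have "heq I (fword z @ w) (fword (hcat I z W))" using hcat_heq by (rule heq_trans)
    then show ?thesis using w topped_cong by blast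
  qed
  have inj: "z = z'" if "z \<in> fheaps I" "z' \<in> fheaps I" "hcat I z W = hcat I z' W" for z z'
  proof -
    have "heq I (fword z @ fword W) (fword z' @ fword W)"
      using hcat_heq[of z W] heq_sym[OF hcat_heq[of z' W]] that(3) heq_trans by metis
    then show ?thesis using heq_cancel_right fheap_eqI[OF that(1,2)] by blast
  qed
  have "sums_bounded val (free_heaps a) (1 / val W)"
  proof (rule sums_boundedI)
    fix F assume F: "finite F" "F \<subseteq> free_heaps a"
    then have Ff: "F \<subseteq> fheaps I" unfolding free_heaps_def by auto
    have "sum val F * val W = (\<Sum>z\<in>F. val (hcat I z W))"
      unfolding sum_distrib_right using Ff W val_hcat by (intro sum.cong) auto
    also have "\<dots> = sum val ((\<lambda>z. hcat I z W) ` F)"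
      using Ff inj by (subst sum.reindex) (auto intro!: inj_onI)
    also have "\<dots> \<le> 1"
    proof (rule sum_val_disjoint)
      fix x y g assume xy: "x \<in> (\<lambda>z. hcat I z W) ` F" "y \<in> (\<lambda>z. hcat I z W) ` F" "g \<in> up I x" "g \<in> up I y"
      have "cnt a v = cnt a W" if v: "v \<in> (\<lambda>z. hcat I z W) ` F" for v
        using v F unfolding free_heaps_def by (auto simp: cnt_hcat)
      then have "cnt a x = cnt a y" using xy by simp
      with xy show "x = y" using top by (intro topped_disjoint[of x y a g]) (auto intro: hcat_fheaps)
    qed (use F hcat_fheaps in auto)
    finally show "sum val F \<le> 1 / val W" using val_pos[OF W] by (simp add: pos_le_divide_eq)
  qed
  then show ?thesis by blast
qed

lemma finite_hsize: "finite {x \<in> fheaps I. hsize x = n}"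
proof (rule finite_imageD)
  have "fword ` {x \<in> fheaps I. hsize x = n} \<subseteq> {w. set w \<subseteq> UNIV \<and> length w = n}"
    by (auto simp: hsize_def)
  then show "finite (fword ` {x \<in> fheaps I. hsize x = n})"
    using finite_lists_length_eq[of "UNIV :: 'a set" n] finite_subset by auto
  show "inj_on fword {x \<in> fheaps I. hsize x = n}"
    by (rule inj_onI) (auto intro!: fheap_eqI)
qed

text \<open>The layer sums of the submonoid of heaps without the letter a are submultiplicative, so
  their mere summability forces exponential decay.\<close>

lemma free_heaps_exponential:
  "\<exists>\<theta>>1. \<exists>M. sums_bounded (\<lambda>x. val x * \<theta> ^ hsize x) (free_heaps a) M"
proof -
  define S where "S n = {x \<in> free_heaps a. hsize x = n}" for n
  define s where "s n = sum val (S n)" for n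
  have finS: "finite (S n)" for n
    unfolding S_def free_heaps_def using finite_hsize[of n] by (rule finite_subset[rotated]) auto
  have s_nonneg: "0 \<le> s n" for n unfolding s_def by (intro sum_nonneg) simp
  have bS: "sums_bounded val (S n) (s n)" for n
    unfolding s_def using finS by (intro sums_boundedI sum_mono2) auto
  have sub: "s (n + m) \<le> s n * s m" for n m
  proof -
    have "sums_bounded val (S (n + m)) (s n * s m)"
    proof (rule sums_bounded_product[OF bS bS, where m = "hcat I"])
      fix x assume x: "x \<in> S (n + m)"
      \<comment> \<open>Cutting the representing word after \<open>n\<close> letters keeps both
        factors free of \<open>a\<close>.\<close>
      let ?p = "heap_of I (take n (fword x))" and ?r = "heap_of I (drop n (fword x))"
      have xf: "x \<in> fheaps I" "a \<notin> set (fword x)" "length (fword x) = n + m"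
        using x unfolding S_def free_heaps_def hsize_def cnt_def by (auto simp: count_mset_0_iff)
      have "length (fword ?p) = n" "length (fword ?r) = m"
        using xf(3) heq_length[OF heap_of_heq] by (metis length_take min_absorb2 le_add1,
          metis length_drop add_diff_cancel_left')
      moreover have "cnt a ?p = 0" "cnt a ?r = 0"
        using xf(2) unfolding cnt_def mset_heap_of
        by (auto simp: count_mset_0_iff dest: in_set_takeD in_set_dropD)
      ultimately have "?p \<in> S n" "?r \<in> S m"
        unfolding S_def free_heaps_def hsize_def using heap_of_fheaps by auto
      moreover have "x = hcat I ?p ?r" using heap_of_fword[OF xf(1)] by (simp add: hcat_heap_of)
      ultimately show "\<exists>p\<in>S n. \<exists>r\<in>S m. x = hcat I p r" by blast
    next
      fix p r assume "p \<in> S n" "r \<in> S m"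
      then show "val (hcat I p r) = val p * val r"
        using val_hcat unfolding S_def free_heaps_def by auto
    qed simp
    then show ?thesis using finS[of "n + m"] unfolding s_def by (intro sums_boundedD) auto
  qed
  obtain M where M: "sums_bounded val (free_heaps a) M" using free_heaps_sum_bounded by blast
  have "summable s"
  proof (rule summableI_nonneg_bounded[OF s_nonneg])
    fix N
    have "(\<Sum>n<N. s n) = sum val (\<Union>n<N. S n)"
      unfolding s_def using finS by (subst sum.UNION_disjoint) (auto simp: S_def)
    also have "\<dots> \<le> M" using finS by (intro sums_boundedD[OF M]) (auto simp: S_def)
    finally show "(\<Sum>n<N. s n) \<le> M" .
  qed
  then have "s \<longlonglongrightarrow> 0" by (rule summable_LIMSEQ_zero)
  then have "\<forall>\<^sub>F n in sequentially. s n < 1" by (rule order_tendstoD) simp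
  then obtain m where m: "s m < 1" by (auto simp: eventually_sequentially)
  \<comment> \<open>By continuity at 1, the strict inequality \<open>s m < 1\<close> leaves room for
    some \<theta> > 1. The weights \<theta>^n preserve submultiplicativity.\<close>
  have "((\<lambda>\<theta>. s m * \<theta> ^ m) \<longlongrightarrow> s m * 1 ^ m) (at_right (1::real))" by (intro tendsto_intros)
  then have "\<forall>\<^sub>F \<theta> in at_right (1::real). s m * \<theta> ^ m < 1" by (rule order_tendstoD) (use m in simp)
  moreover have "\<forall>\<^sub>F \<theta> in at_right (1::real). \<theta> > 1" by (rule eventually_at_right_less)
  ultimately have "\<forall>\<^sub>F \<theta> in at_right (1::real). s m * \<theta> ^ m < 1 \<and> \<theta> > 1" by (rule eventually_conj)
  then obtain \<theta> :: real where \<theta>: "s m * \<theta> ^ m < 1" "\<theta> > 1"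
    using eventually_happens trivial_limit_at_right_real by (metis (no_types, lifting))
  define t where "t n = s n * \<theta> ^ n" for n
  have "summable t"
  proof (rule submultiplicative_summable[of t m])
    show "t (n + m) \<le> t n * t m" for n m
      using mult_right_mono[OF sub[of n m], of "\<theta> ^ n * \<theta> ^ m"] \<theta>(2)
      by (simp add: t_def power_add mult_ac)
  qed (use s_nonneg \<theta> in \<open>auto simp: t_def\<close>)
  moreover have "sums_bounded (\<lambda>x. val x * \<theta> ^ hsize x) {x \<in> free_heaps a. hsize x = n} (t n)" for n
  proof (rule sums_boundedI)
    fix F assume F: "finite F" "F \<subseteq> {x \<in> free_heaps a. hsize x = n}"
    then have "(\<Sum>x\<in>F. val x * \<theta> ^ hsize x) = sum val F * \<theta> ^ n"
      unfolding sum_distrib_right by (intro sum.cong) auto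
    also have "\<dots> \<le> t n" unfolding t_def
      using F \<theta>(2) by (intro mult_right_mono sums_boundedD[OF bS]) (auto simp: S_def)
    finally show "(\<Sum>x\<in>F. val x * \<theta> ^ hsize x) \<le> t n" .
  qed
  ultimately show ?thesis using sums_bounded_fibers \<theta>(2) by blast
qed

text \<open>Removing the top \<open>a\<close> from a pyramid leaves a heap without \<open>a\<close>,
  so the decay carries over up to a constant.\<close>

lemma pyramids_exponential:
  assumes "\<theta> > 1" "sums_bounded (\<lambda>x. val x * \<theta> ^ hsize x) (free_heaps a) M"
  shows "\<exists>M. sums_bounded (\<lambda>x. val x * \<theta> ^ hsize x) (pyramids a) M"
proof -
  define A where "A = heap_of I [a]"
  have A: "A \<in> fheaps I" unfolding A_def by (rule heap_of_fheaps)
  have "sums_bounded (\<lambda>x. val x * \<theta> ^ hsize x) {A} (val A * \<theta> ^ hsize A)"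
  proof (rule sums_boundedI)
    fix F assume "finite F" "F \<subseteq> {A}"
    then have "F = {} \<or> F = {A}" by auto
    then show "(\<Sum>x\<in>F. val x * \<theta> ^ hsize x) \<le> val A * \<theta> ^ hsize A" using assms(1) by auto
  qed
  with assms(2) have "sums_bounded (\<lambda>x. val x * \<theta> ^ hsize x) (pyramids a) (M * (val A * \<theta> ^ hsize A))"
  proof (rule sums_bounded_product[where m = "hcat I"])
    fix x assume "x \<in> pyramids a"
    then have x: "x \<in> fheaps I" "topped a (fword x)" "count (mset (fword x)) a = 1"
      unfolding pyramids_def cnt_def by auto
    then obtain u where u: "heq I (fword x) (u @ [a])" "a \<notin> set u" using topped_snoc by blast
    have "x = hcat I (heap_of I u) A"
      unfolding A_def hcat_heap_of using heap_of_eqI[OF x(1) heq_sym[OF u(1)]] by simp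
    moreover have "heap_of I u \<in> free_heaps a"
      unfolding free_heaps_def cnt_def using heap_of_fheaps u(2) heq_set[OF heap_of_heq[of u]]
      by (simp add: count_mset_0_iff)
    ultimately show "\<exists>p\<in>free_heaps a. \<exists>r\<in>{A}. x = hcat I p r" by blast
  next
    fix p r assume "p \<in> free_heaps a" "r \<in> {A}"
    then show "val (hcat I p r) * \<theta> ^ hsize (hcat I p r) = val p * \<theta> ^ hsize p * (val r * \<theta> ^ hsize r)"
      using A unfolding free_heaps_def by (simp add: val_hcat hsize_hcat power_add)
  qed (use assms(1) in auto)
  then show ?thesis by blast
qed

lemma cost_abs_le:
  fixes \<psi> :: "'a \<Rightarrow> real"
  shows "\<exists>K>0. \<forall>x. \<bar>cost \<psi> x\<bar> \<le> K * real (hsize x)"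
proof -
  define K where "K = 1 + (\<Sum>b\<in>UNIV. \<bar>\<psi> b\<bar>)"
  have K: "\<bar>\<psi> b\<bar> \<le> K" for b
    using member_le_sum[of b UNIV "\<lambda>b. \<bar>\<psi> b\<bar>"] unfolding K_def by simp
  have "\<bar>sum_list (map \<psi> w)\<bar> \<le> K * real (length w)" for w
  proof (induction w)
    case (Cons b w)
    then show ?case using K[of b] by (simp add: algebra_simps)
  qed simp
  moreover have "K > 0" unfolding K_def by (intro add_pos_nonneg sum_nonneg) auto
  ultimately show ?thesis unfolding cost_def hsize_def by blast
qed

text \<open>The cost is at most linear in the length n, and n * ln \<theta> \<le> \<theta>^n, so the
  exponential moment dominates.\<close>

lemma pyramids_cost_summable:
  fixes \<psi> :: "'a \<Rightarrow> real"
  shows "(\<lambda>x. val x * cost \<psi> x) summable_on pyramids a"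
proof -
  obtain \<theta> M where \<theta>: "\<theta> > 1" and M: "sums_bounded (\<lambda>x. val x * \<theta> ^ hsize x) (free_heaps a) M"
    using free_heaps_exponential by blast
  obtain M' where M': "sums_bounded (\<lambda>x. val x * \<theta> ^ hsize x) (pyramids a) M'"
    using pyramids_exponential[OF \<theta> M] by blast
  obtain K where K: "K > 0" "\<And>x. \<bar>cost \<psi> x\<bar> \<le> K * real (hsize x)" using cost_abs_le by blast
  define C where "C = K / ln \<theta>"
  have "\<bar>cost \<psi> x\<bar> \<le> C * \<theta> ^ hsize x" for x
  proof -
    have "real (hsize x) * ln \<theta> \<le> exp (real (hsize x) * ln \<theta>)"
      using exp_ge_add_one_self[of "real (hsize x) * ln \<theta>"] by linarith
    also have "\<dots> = \<theta> ^ hsize x" using \<theta> by (simp add: exp_of_nat_mult)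
    finally have "K * real (hsize x) \<le> K * (\<theta> ^ hsize x / ln \<theta>)"
      using K(1) \<theta> by (intro mult_left_mono) (simp_all add: pos_le_divide_eq)
    then show ?thesis using K(2)[of x] unfolding C_def by simp
  qed
  from mult_left_mono[OF this val_nonneg]
  have le: "norm (val x * cost \<psi> x) \<le> C * (val x * \<theta> ^ hsize x)" for x
    by (simp add: abs_mult mult_ac)
  have "(\<lambda>x. val x * \<theta> ^ hsize x) summable_on pyramids a"
    using M' by (rule sums_bounded_summable) (use \<theta> in auto)
  then have "(\<lambda>x. C * (val x * \<theta> ^ hsize x)) summable_on pyramids a"
    by (rule summable_on_cmult_right)
  from Infinite_Sum.abs_summable_on_comparison_test'[OF this le]
  show ?thesis by (rule Infinite_Sum.abs_summable_summable)
qed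

text \<open>A heap with k occurrences of a is a product of k pyramids and a heap without a, so the
  exponentially tilted valuation sums to a geometric series as soon as its mass on the
  pyramids is below 1.  The negative drift of \<psi> over the pyramids ensures this for a small tilt.\<close>

lemma tilted_sum_bounded:
  assumes drift: "infsum (\<lambda>x. val x * cost \<psi> x) (pyramids a) < 0"
  shows "\<exists>t>0. \<exists>M. sums_bounded (\<lambda>x. val x * exp (t * cost \<psi> x)) (fheaps I) M"
proof -
  obtain \<theta> M where \<theta>: "\<theta> > 1" and M: "sums_bounded (\<lambda>x. val x * \<theta> ^ hsize x) (free_heaps a) M"
    using free_heaps_exponential by blast
  obtain M' where M': "sums_bounded (\<lambda>x. val x * \<theta> ^ hsize x) (pyramids a) M'"
    using pyramids_exponential[OF \<theta> M] by blast
  obtain K where K: "K > 0" "\<And>x. \<bar>cost \<psi> x\<bar> \<le> K * real (hsize x)" using cost_abs_le by blast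
  \<comment> \<open>Chosen so that \<open>2 * t0 * K = ln \<theta>\<close>: the exponential in
    \<open>exp_quadratic_bound\<close> is then at most \<open>\<theta> ^ hsize x\<close>.\<close>
  define t0 where "t0 = ln \<theta> / (2 * K)"
  have t0: "t0 > 0" using \<theta> K unfolding t0_def by simp
  have exp_le: "exp (2 * t0 * \<bar>cost \<psi> x\<bar>) \<le> \<theta> ^ hsize x" for x
  proof -
    have "2 * t0 * \<bar>cost \<psi> x\<bar> \<le> 2 * t0 * (K * real (hsize x))"
      using K t0 by (intro mult_left_mono) auto
    also have "\<dots> = real (hsize x) * ln \<theta>" unfolding t0_def using K by simp
    finally have "exp (2 * t0 * \<bar>cost \<psi> x\<bar>) \<le> exp (real (hsize x) * ln \<theta>)" by simp
    also have "\<dots> = \<theta> ^ hsize x" using \<theta> by (simp add: exp_of_nat_mult)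
    finally show ?thesis .
  qed
  define C where "C = 2 / t0\<^sup>2"
  have C: "C > 0" using t0 unfolding C_def by simp
  let ?\<theta> = "\<lambda>x. val x * \<theta> ^ hsize x" and ?\<psi> = "\<lambda>x. val x * cost \<psi> x"
  let ?P = "pyramids a"
  have nn: "0 \<le> ?\<theta> x" for x using \<theta> by simp
  have s1: "val summable_on ?P" "infsum val ?P \<le> 1"
    using sums_bounded_summable[OF pyramids_sum_le_1] by auto
  have s3: "?\<theta> summable_on ?P" "infsum ?\<theta> ?P \<le> M'" using sums_bounded_summable[OF M' nn] by auto
  have s2: "?\<psi> summable_on ?P" by (rule pyramids_cost_summable)
  define \<kappa> where "\<kappa> = - infsum ?\<psi> ?P"
  have \<kappa>: "\<kappa> > 0" using drift unfolding \<kappa>_def by simp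
  \<comment> \<open>\<open>C * M'\<close> bounds the quadratic coefficient; the summand 1 makes
    \<open>B\<close> strictly positive. The choice of \<open>t\<close> below caps the quadratic term
    at half of the linear gain \<open>t * \<kappa>\<close>.\<close>
  define B where "B = C * M' + 1"
  have B: "B > 0" using C sums_bounded_nonneg[OF M'] unfolding B_def by (intro add_nonneg_pos) auto
  define t where "t = min t0 (\<kappa> / (2 * B))"
  have t: "t > 0" "t \<le> t0" "t * B \<le> \<kappa> / 2"
    using t0 \<kappa> B unfolding t_def by (auto simp: min_def field_simps)
  let ?g = "\<lambda>x. val x * exp (t * cost \<psi> x)"
  have g_le: "?g x \<le> ?\<theta> x" for x
  proof -
    have "t * cost \<psi> x \<le> t * \<bar>cost \<psi> x\<bar>" using t by (intro mult_left_mono) auto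
    also have "\<dots> \<le> (2 * t0) * \<bar>cost \<psi> x\<bar>" using t t0 by (intro mult_right_mono) auto
    finally have "exp (t * cost \<psi> x) \<le> \<theta> ^ hsize x" using exp_le[of x] by (meson exp_le_cancel_iff order_trans)
    then show ?thesis by (intro mult_left_mono) auto
  qed
  define \<rho> where "\<rho> = 1 - t * \<kappa> / 2"
  have "\<rho> < 1" using t \<kappa> unfolding \<rho>_def by simp
  have gP: "sums_bounded ?g ?P \<rho>"
  proof (rule sums_boundedI)
    fix F assume F: "finite F" "F \<subseteq> ?P"
    have sg: "?g summable_on ?P"
      using s3(1) g_le by (rule summable_on_comparison_test) simp
    have "sum ?g F \<le> infsum ?g ?P" using sg F by (intro finite_sum_le_infsum) auto
    also have "\<dots> \<le> infsum (\<lambda>x. val x + (t * ?\<psi> x + t\<^sup>2 * C * ?\<theta> x)) ?P"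
    proof (rule infsum_mono[OF sg])
      show "(\<lambda>x. val x + (t * ?\<psi> x + t\<^sup>2 * C * ?\<theta> x)) summable_on ?P"
        by (intro summable_on_add summable_on_cmult_right s1 s2 s3)
      fix x
      have "exp (t * cost \<psi> x) \<le> 1 + t * cost \<psi> x + t\<^sup>2 * (C * exp (2 * t0 * \<bar>cost \<psi> x\<bar>))"
        unfolding C_def using t t0 by (intro exp_quadratic_bound) auto
      also have "\<dots> \<le> 1 + t * cost \<psi> x + t\<^sup>2 * (C * \<theta> ^ hsize x)"
        using exp_le[of x] C by (intro add_left_mono mult_left_mono) auto
      finally have "?g x \<le> val x * (1 + t * cost \<psi> x + t\<^sup>2 * (C * \<theta> ^ hsize x))"
        by (intro mult_left_mono) auto
      then show "?g x \<le> val x + (t * ?\<psi> x + t\<^sup>2 * C * ?\<theta> x)" by (simp add: algebra_simps)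
    qed
    also have "\<dots> = infsum val ?P + (t * infsum ?\<psi> ?P + t\<^sup>2 * C * infsum ?\<theta> ?P)"
      by (subst infsum_add infsum_cmult_right; (intro summable_on_add summable_on_cmult_right s1 s2 s3)?)+ simp
    also have "\<dots> \<le> 1 + (t * (- \<kappa>) + t\<^sup>2 * C * M')"
      using s1 s3 t C unfolding \<kappa>_def by (intro add_mono mult_left_mono) auto
    also have "t\<^sup>2 * C * M' \<le> t * (t * B)"
      using t unfolding B_def by (simp add: power2_eq_square algebra_simps)
    also have "t * (t * B) \<le> t * (\<kappa> / 2)" using t by (intro mult_left_mono) auto
    finally show "sum ?g F \<le> \<rho>" unfolding \<rho>_def by (simp add: algebra_simps)
  qed
  have "0 \<le> \<rho>" using sums_bounded_nonneg[OF gP] .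
  have gmult: "?g (hcat I x y) = ?g x * ?g y" if "x \<in> fheaps I" "y \<in> fheaps I" for x y
    using that by (simp add: val_hcat cost_hcat distrib_left exp_add)
  \<comment> \<open>Each induction step peels off one pyramid, of tilted mass at most
    \<open>\<rho>\<close>; what remains at \<open>k = 0\<close> is a heap without
    \<open>a\<close>.\<close>
  have gk: "sums_bounded ?g {x \<in> fheaps I. cnt a x = k} (\<rho> ^ k * M)" for k
  proof (induction k)
    case 0
    show ?case using M g_le by (rule sums_bounded_mono) (auto simp: free_heaps_def)
  next
    case (Suc k)
    have "sums_bounded ?g {x \<in> fheaps I. cnt a x = Suc k} (\<rho> * (\<rho> ^ k * M))"
    proof (rule sums_bounded_product[OF gP Suc, where m = "hcat I"])
      fix x assume "x \<in> {x \<in> fheaps I. cnt a x = Suc k}"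
      then have x: "x \<in> fheaps I" "count (mset (fword x)) a = Suc k" by (auto simp: cnt_def)
      then have "a \<in> set (fword x)" by (metis count_mset_0_iff nat.distinct(1))
      then obtain p y where p: "heq I (fword x) (p @ y)" "topped a p" "count (mset p) a = 1"
        using topped_prefix by blast
      have "x = hcat I (heap_of I p) (heap_of I y)"
        unfolding hcat_heap_of using heap_of_eqI[OF x(1) heq_sym[OF p(1)]] by simp
      moreover have "heap_of I p \<in> pyramids a"
        unfolding pyramids_def cnt_def
        using heap_of_fheaps p topped_cong[OF heap_of_heq[of p]] by (auto simp: mset_heap_of)
      moreover have "cnt a (heap_of I y) = k"
        unfolding cnt_def mset_heap_of using x(2) p(3) heq_mset[OF p(1)] by simp
      ultimately show "\<exists>p\<in>?P. \<exists>r\<in>{x \<in> fheaps I. cnt a x = k}. x = hcat I p r"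
        using heap_of_fheaps by blast
    qed (auto simp: gmult pyramids_def)
    then show ?case by (simp add: mult_ac)
  qed
  have "summable (\<lambda>k. \<rho> ^ k * M)" using \<open>\<rho> < 1\<close> \<open>0 \<le> \<rho>\<close> by (intro summable_mult2 summable_geometric) auto
  from sums_bounded_fibers[of ?g "fheaps I" "cnt a", OF gk this] show ?thesis using t by blast
qed

lemma large_cost_bounded:
  assumes "infsum (\<lambda>x. val x * cost \<psi> x) (pyramids a) < 0"
  shows "\<exists>M. sums_bounded val {x \<in> fheaps I. 0 \<le> cost \<psi> x} M"
proof -
  obtain t M where t: "t > 0" and M: "sums_bounded (\<lambda>x. val x * exp (t * cost \<psi> x)) (fheaps I) M"
    using tilted_sum_bounded[OF assms] by blast
  have "sums_bounded val {x \<in> fheaps I. 0 \<le> cost \<psi> x} M"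
  proof (rule sums_bounded_mono[OF M])
    fix x assume "x \<in> {x \<in> fheaps I. 0 \<le> cost \<psi> x}"
    then have "1 \<le> exp (t * cost \<psi> x)" using t by simp
    then show "val x \<le> val x * exp (t * cost \<psi> x)" using mult_left_mono[of 1 _ "val x"] by simp
  qed auto
  then show ?thesis by blast
qed

subsection \<open>Almost sure convergence along subheaps\<close>

lemma countable_fheaps: "countable (fheaps I)"
proof (rule countable_image_inj_on)
  show "countable (fword ` fheaps I)" by simp
  show "inj_on fword (fheaps I)" by (rule inj_onI) (auto intro: fheap_eqI)
qed

lemma AE_finitely_many_below:
  assumes B: "B \<subseteq> fheaps I" and M: "sums_bounded val B M"
  shows "AE g in P. finite {x \<in> B. mle I x g}"
proof (cases "finite B")
  case True
  then show ?thesis by simp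
next
  case False
  define e where "e = from_nat_into B"
  have cB: "countable B" using B countable_fheaps countable_subset by blast
  then have e: "bij_betw e UNIV B" unfolding e_def using False by (rule bij_betw_from_nat_into)
  then have eB: "e n \<in> B" for n by (auto simp: bij_betw_def)
  have "summable (\<lambda>n. measure P (up I (e n)))"
  proof (rule summableI_nonneg_bounded)
    fix n
    have "(\<Sum>i<n. measure P (up I (e i))) = sum val (e ` {..<n})"
      using e unfolding val_def by (subst sum.reindex) (auto simp: bij_betw_def intro: inj_on_subset)
    also have "\<dots> \<le> M" using eB by (intro sums_boundedD[OF M]) auto
    finally show "(\<Sum>i<n. measure P (up I (e i))) \<le> M" .
  qed simp
  then have "AE g in P. eventually (\<lambda>n. g \<in> space P - up I (e n)) sequentially"
    using eB B up_sets by (intro borel_cantelli_AE1) (auto simp: emeasure_eq_measure)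
  then show ?thesis
  proof (rule AE_mp, intro AE_I2 impI)
    fix g assume g: "g \<in> space P" "eventually (\<lambda>n. g \<in> space P - up I (e n)) sequentially"
    then obtain N where N: "\<And>n. n \<ge> N \<Longrightarrow> g \<notin> up I (e n)" by (auto simp: eventually_sequentially)
    have "{x \<in> B. mle I x g} \<subseteq> e ` {..<N}"
    proof
      fix x assume x: "x \<in> {x \<in> B. mle I x g}"
      then obtain n where n: "x = e n" using e by (auto simp: bij_betw_def)
      then have "g \<in> up I (e n)" using x g(1) space_P unfolding up_def by auto
      then show "x \<in> e ` {..<N}" using N n by (metis imageI lessThan_iff not_le)
    qed
    then show "finite {x \<in> B. mle I x g}" by (rule finite_subset) simp
  qed
qed

lemma cost_affine: "cost (\<lambda>b. \<alpha> * \<phi> b + \<beta>) x = \<alpha> * cost \<phi> x + \<beta> * real (hsize x)"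
proof -
  have "sum_list (map (\<lambda>b. \<alpha> * \<phi> b + \<beta>) w) = \<alpha> * sum_list (map \<phi> w) + \<beta> * real (length w)" for w
    by (induction w) (auto simp: algebra_simps)
  then show ?thesis by (simp add: cost_def hsize_def)
qed

text \<open>Ensures that the mean length of a pyramid is positive, so that it may be divided
  by.\<close>

lemma single_pyramid: "heap_of I [a] \<in> pyramids a" "hsize (heap_of I [a]) = 1"
proof -
  have "topped a [a]"
    unfolding topped_def
  proof (intro allI impI, elim conjE)
    fix c d assume cd: "heq I [a] (c @ d)" "d \<noteq> []"
    then have "set d \<noteq> {}" "set d \<subseteq> {a}" using heq_set[OF cd(1)] by auto
    then have "set d = {a}" using subset_singletonD by metis
    then show "a \<in> set d" by simp
  qed
  then have "topped a (fword (heap_of I [a]))" using topped_cong[OF heap_of_heq] by blast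
  then show "heap_of I [a] \<in> pyramids a"
    unfolding pyramids_def cnt_def using heap_of_fheaps by (simp add: mset_heap_of)
  show "hsize (heap_of I [a]) = 1"
    using heq_length[OF heap_of_heq[of "[a]"]] by (simp add: hsize_def)
qed

text \<open>The sequence \<open>xs\<close> is quantified inside \<open>AE\<close>: a single null set
  must serve all sequences, which may depend on \<open>g\<close>.\<close>

lemma subheap_means_converge:
  fixes \<phi> :: "'a \<Rightarrow> real"
  shows "\<exists>c. AE g in P. \<forall>xs. (\<forall>n. xs n \<in> fheaps I \<and> mle I (xs n) g) \<longrightarrow>
    filterlim (\<lambda>n. hsize (xs n)) at_top sequentially \<longrightarrow>
    (\<lambda>n. cost \<phi> (xs n) / real (hsize (xs n))) \<longlonglongrightarrow> c"
proof -
  define a :: 'a where "a = undefined"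
  define L where "L = infsum (\<lambda>x. val x * cost (\<lambda>_. 1) x) (pyramids a)"
  define c where "c = infsum (\<lambda>x. val x * cost \<phi> x) (pyramids a) / L"
  have cost_1: "cost (\<lambda>_. 1) x = real (hsize x)" for x :: "'a cfseq"
    using cost_affine[of 0 "\<lambda>_. 0" 1 x] by simp
  have L: "L > 0"
  proof -
    have "sum (\<lambda>x. val x * cost (\<lambda>_. 1) x) {heap_of I [a]} \<le> L"
      unfolding L_def using single_pyramid(1)
      by (intro finite_sum_le_infsum[OF pyramids_cost_summable]) (auto simp: cost_1)
    then show ?thesis using single_pyramid(2) val_pos[OF heap_of_fheaps[of "[a]"]] by (simp add: cost_1)
  qed
  have drift: "infsum (\<lambda>x. val x * cost (\<lambda>b. \<alpha> * \<phi> b + \<beta>) x) (pyramids a) = \<alpha> * (c * L) + \<beta> * L" for \<alpha> \<beta>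
  proof -
    have "infsum (\<lambda>x. val x * cost (\<lambda>b. \<alpha> * \<phi> b + \<beta>) x) (pyramids a) =
      infsum (\<lambda>x. \<alpha> * (val x * cost \<phi> x) + \<beta> * (val x * cost (\<lambda>_. 1) x)) (pyramids a)"
      unfolding cost_affine by (intro infsum_cong) (simp add: cost_1 algebra_simps)
    also have "\<dots> = \<alpha> * infsum (\<lambda>x. val x * cost \<phi> x) (pyramids a) + \<beta> * L"
      unfolding L_def
      by (simp only: infsum_add[OF summable_on_cmult_right[OF pyramids_cost_summable]
            summable_on_cmult_right[OF pyramids_cost_summable]] infsum_cmult_right')
    also have "infsum (\<lambda>x. val x * cost \<phi> x) (pyramids a) = c * L" using L by (simp add: c_def)
    finally show ?thesis .
  qed
  \<comment> \<open>With \<alpha> = 1 and \<alpha> = -1 this covers upward and downward deviations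
    from c; the condition on \<alpha> and \<beta> is negative drift.\<close>
  have AE_bad: "AE g in P. finite {x \<in> {x \<in> fheaps I. 0 \<le> \<alpha> * cost \<phi> x + \<beta> * real (hsize x)}. mle I x g}"
    if "\<alpha> * c + \<beta> < 0" for \<alpha> \<beta>
  proof -
    have "(\<alpha> * c + \<beta>) * L < 0" using that L by (simp add: mult_neg_pos)
    then have "infsum (\<lambda>x. val x * cost (\<lambda>b. \<alpha> * \<phi> b + \<beta>) x) (pyramids a) < 0"
      unfolding drift by (simp add: algebra_simps)
    then obtain M where "sums_bounded val {x \<in> fheaps I. 0 \<le> cost (\<lambda>b. \<alpha> * \<phi> b + \<beta>) x} M"
      using large_cost_bounded by blast
    then show ?thesis unfolding cost_affine by (intro AE_finitely_many_below) auto
  qed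
  define bad where "bad \<epsilon> g = {x \<in> fheaps I. mle I x g \<and> \<epsilon> * real (hsize x) \<le> \<bar>cost \<phi> x - c * real (hsize x)\<bar>}" for \<epsilon> g
  have "AE g in P. finite (bad \<epsilon> g)" if "\<epsilon> > 0" for \<epsilon>
  proof -
    have "AE g in P. finite {x \<in> {x \<in> fheaps I. 0 \<le> 1 * cost \<phi> x + (- c - \<epsilon>) * real (hsize x)}. mle I x g} \<and>
      finite {x \<in> {x \<in> fheaps I. 0 \<le> (- 1) * cost \<phi> x + (c - \<epsilon>) * real (hsize x)}. mle I x g}"
      using that by (intro AE_conjI AE_bad) auto
    then show ?thesis
    proof (rule AE_mp, intro AE_I2 impI, elim conjE)
      fix g
      let ?A = "{x \<in> {x \<in> fheaps I. 0 \<le> 1 * cost \<phi> x + (- c - \<epsilon>) * real (hsize x)}. mle I x g}"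
        and ?B = "{x \<in> {x \<in> fheaps I. 0 \<le> (- 1) * cost \<phi> x + (c - \<epsilon>) * real (hsize x)}. mle I x g}"
      assume "finite ?A" "finite ?B"
      moreover have "bad \<epsilon> g \<subseteq> ?A \<union> ?B" unfolding bad_def by (auto simp: algebra_simps abs_real_def split: if_splits)
      ultimately show "finite (bad \<epsilon> g)" using finite_subset by blast
    qed
  qed
  \<comment> \<open>Only countably many tolerances are used, so the exceptional sets still unite to
    a null set.\<close>
  then have "AE g in P. \<forall>m::nat. finite (bad (1 / Suc m) g)" by (subst AE_all_countable) simp
  then have "AE g in P. \<forall>xs. (\<forall>n. xs n \<in> fheaps I \<and> mle I (xs n) g) \<longrightarrow>
    filterlim (\<lambda>n. hsize (xs n)) at_top sequentially \<longrightarrow>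
    (\<lambda>n. cost \<phi> (xs n) / real (hsize (xs n))) \<longlonglongrightarrow> c"
  proof (rule AE_mp, intro AE_I2 impI allI)
    fix g xs
    assume fin: "\<forall>m::nat. finite (bad (1 / Suc m) g)"
      and xs: "\<forall>n. xs n \<in> fheaps I \<and> mle I (xs n) g"
      and lim: "filterlim (\<lambda>n. hsize (xs n)) at_top sequentially"
    show "(\<lambda>n. cost \<phi> (xs n) / real (hsize (xs n))) \<longlonglongrightarrow> c"
    proof (rule tendstoI)
      fix r :: real assume "r > 0"
      then obtain m :: nat where m: "1 / Suc m < r" using nat_approx_posE by blast
      obtain B where B: "\<And>x. x \<in> bad (1 / Suc m) g \<Longrightarrow> hsize x \<le> B"
        using fin finite_nat_set_iff_bounded_le[of "hsize ` bad (1 / Suc m) g"] by blast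
      have "eventually (\<lambda>n. Suc B \<le> hsize (xs n)) sequentially"
        using lim unfolding filterlim_at_top by blast
      then show "eventually (\<lambda>n. dist (cost \<phi> (xs n) / real (hsize (xs n))) c < r) sequentially"
      proof eventually_elim
        case (elim n)
        then have "xs n \<notin> bad (1 / Suc m) g" using B by fastforce
        then have lt: "\<bar>cost \<phi> (xs n) - c * real (hsize (xs n))\<bar> < 1 / Suc m * real (hsize (xs n))"
          unfolding bad_def using xs by auto
        have pos: "0 < real (hsize (xs n))" using elim by simp
        have "\<bar>cost \<phi> (xs n) / real (hsize (xs n)) - c\<bar> = \<bar>cost \<phi> (xs n) - c * real (hsize (xs n))\<bar> / real (hsize (xs n))"
        proof -
          have "cost \<phi> (xs n) / real (hsize (xs n)) - c = (cost \<phi> (xs n) - c * real (hsize (xs n))) / real (hsize (xs n))"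
            using pos by (simp add: diff_divide_distrib)
          then show ?thesis by (simp add: abs_divide)
        qed
        also have "\<dots> < 1 / Suc m" using lt pos by (simp only: pos_divide_less_eq)
        finally show ?case using m by (simp add: dist_real_def)
      qed
    qed
  qed
  then show ?thesis by blast
qed

subsection \<open>Iterated stopping times\<close>

text \<open>The finite values y of V have disjoint cylinders of total mass 1, hence by multiplicativity
  the cylinders of x . y exhaust the cylinder of x.\<close>

lemma AE_finite_after:
  assumes V: "AST I V" and fin: "AE g in P. V g \<in> fheaps I" and x: "x \<in> fheaps I"
  shows "AE g in P. mle I x g \<longrightarrow> V (hminus I g x) \<in> fheaps I"
proof -
  define Y where "Y = V ` bdry I \<inter> fheaps I"
  have cY: "countable Y" unfolding Y_def using countable_fheaps countable_subset by blast
  have Yf: "y \<in> fheaps I" if "y \<in> Y" for y using that unfolding Y_def by blast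
  \<comment> \<open>The stopping property makes V constant on the cylinder of each finite value.
    Events about V thus become countable unions of cylinders, measurable without any regularity of V
    itself.\<close>
  have stop: "V z = y" if "y \<in> Y" "z \<in> bdry I" "mle I y z" for y z
    using V that unfolding AST_def Y_def by blast
  have sets: "up I (hcat I x y) \<in> sets P" for x y using up_sets hcat_fheaps by blast
  let ?E = "\<Union>y\<in>Y. up I (hcat I x y)"
  have prefix: "g \<in> bdry I \<and> mle I x g \<and> mle I y (hminus I g x)" if "y \<in> Y" "g \<in> up I (hcat I x y)" for g y
  proof -
    have g: "g \<in> bdry I" "mle I (hcat I x y) g" using that unfolding up_def by auto
    then have "fword (hcat I x y) \<in> below g" using mle_fheap_iff[OF hcat_fheaps] bdry_Mbar by blast
    moreover have "hle I (fword x) (fword (hcat I x y))"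
      using hle_heq_trans[OF hle_append hcat_heq] .
    ultimately have "fword x \<in> below g" unfolding below_def using hle_trans by blast
    then have "mle I x g" using mle_fheap_iff[OF x] bdry_Mbar g by blast
    then show ?thesis using g hcat_mle_iff[OF x Yf[OF that(1)]] by blast
  qed
  have "1 = emeasure P (\<Union>y\<in>Y. up I y)"
  proof -
    have "AE g in P. g \<in> (\<Union>y\<in>Y. up I y)"
      using fin
    proof (rule AE_mp, intro AE_I2 impI)
      fix g assume g: "g \<in> space P" "V g \<in> fheaps I"
      then have gb: "g \<in> bdry I" using space_P by simp
      then have "mle I (V g) g" using V unfolding AST_def by blast
      then have "V g \<in> Y" "g \<in> up I (V g)" using g gb unfolding Y_def up_def by auto
      then show "g \<in> (\<Union>y\<in>Y. up I y)" by blast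
    qed
    moreover have "(\<Union>y\<in>Y. up I y) \<in> sets P" using cY Yf up_sets by (intro sets.countable_UN') auto
    ultimately show ?thesis using emeasure_eq_1_AE by simp
  qed
  also have "\<dots> = (\<integral>\<^sup>+y. emeasure P (up I y) \<partial>count_space Y)"
  proof (rule emeasure_UN_countable[OF up_sets[OF Yf] cY])
    show "disjoint_family_on (up I) Y"
      unfolding disjoint_family_on_def up_def using stop by blast
  qed
  finally have one: "(\<integral>\<^sup>+y. emeasure P (up I y) \<partial>count_space Y) = 1" by simp
  have "emeasure P ?E = (\<integral>\<^sup>+y. emeasure P (up I (hcat I x y)) \<partial>count_space Y)"
  proof (rule emeasure_UN_countable[OF sets cY])
    \<comment> \<open>A common point \<open>g\<close> would put \<open>hminus I g x\<close> into the
      cylinders of two values of V.\<close>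
    show "disjoint_family_on (\<lambda>y. up I (hcat I x y)) Y"
      unfolding disjoint_family_on_def using stop prefix hminus_props(1)[OF x] by blast
  qed
  also have "\<dots> = (\<integral>\<^sup>+y. emeasure P (up I x) * emeasure P (up I y) \<partial>count_space Y)"
    using val_hcat[OF x Yf] by (intro nn_integral_cong) (simp add: emeasure_eq_measure val_def ennreal_mult)
  also have "\<dots> = emeasure P (up I x)" by (simp add: nn_integral_cmult one)
  finally have eq: "emeasure P ?E = emeasure P (up I x)" .
  have E: "?E \<in> sets P" using cY sets by (intro sets.countable_UN') auto
  have "?E \<subseteq> up I x" using prefix unfolding up_def by blast
  then have "emeasure P (up I x - ?E) = 0"
    using emeasure_Diff[OF _ up_sets[OF x] E] eq by (simp add: emeasure_eq_measure)
  then have "AE g in P. g \<notin> up I x - ?E"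
    using up_sets[OF x] E by (intro AE_not_in) (auto simp: null_sets_def)
  then show ?thesis
  proof (rule AE_mp, intro AE_I2 impI)
    fix g assume g: "g \<in> space P" "g \<notin> up I x - ?E" "mle I x g"
    then have "g \<in> ?E" using space_P unfolding up_def by auto
    then obtain y where y: "y \<in> Y" "g \<in> up I (hcat I x y)" by blast
    then show "V (hminus I g x) \<in> fheaps I"
      using stop[OF y(1) hminus_props(1)[OF x]] prefix[OF y] Yf by auto
  qed
qed

text \<open>The hypothesis \<open>fin\<close> ranges over all finite subheaps of \<open>g\<close>,
  since the iterates reached depend on \<open>g\<close>. It keeps the recursion among finite heaps,
  where \<open>hmult\<close> is concatenation.\<close>

lemma iterV_finite:
  assumes V: "AST I V" and g: "g \<in> bdry I"
    and fin: "\<And>x. x \<in> fheaps I \<Longrightarrow> mle I x g \<Longrightarrow> V (hminus I g x) \<in> fheaps I"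
  shows "iterV I V n g \<in> fheaps I" "mle I (iterV I V n g) g"
    and "hle I (fword (iterV I V n g)) (fword (iterV I V (Suc n) g))"
proof -
  have step: "iterV I V (Suc n) g = hcat I (iterV I V n g) (V (hminus I g (iterV I V n g)))"
    if "iterV I V n g \<in> fheaps I" "mle I (iterV I V n g) g" for n
    using that fin hmult_fheap Mbar_cases[OF fheaps_Mbar] by auto
  have inv: "iterV I V n g \<in> fheaps I \<and> mle I (iterV I V n g) g" for n
  proof (induction n)
    case 0
    have "hle I [] (pword g 0)" by simp
    then have "[] \<in> below g" unfolding below_def by blast
    then show ?case using hzero_fheap mle_fheap_iff[OF hzero_fheap(1) bdry_Mbar[OF g]] by simp
  next
    case (Suc n)
    let ?x = "iterV I V n g"
    have x: "?x \<in> fheaps I" "mle I ?x g" using Suc by auto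
    have z: "hminus I g ?x \<in> bdry I" by (rule hminus_props[OF x(1) g x(2)])
    then have "mle I (V (hminus I g ?x)) (hminus I g ?x)" using V unfolding AST_def by blast
    then have "mle I (hcat I ?x (V (hminus I g ?x))) g" using hcat_mle_iff[OF x(1) fin[OF x] g x(2)] by blast
    then show ?case using step[OF x] hcat_fheaps by simp
  qed
  then show "iterV I V n g \<in> fheaps I" "mle I (iterV I V n g) g" by auto
  show "hle I (fword (iterV I V n g)) (fword (iterV I V (Suc n) g))"
    unfolding step[OF conjunct1[OF inv] conjunct2[OF inv]] using hle_heq_trans[OF hle_append hcat_heq] .
qed

lemma exhaustive_converges:
  assumes V: "AST I V" and ex: "exhaustive I P V"
    and conv: "AE g in P. \<forall>xs. (\<forall>n. xs n \<in> fheaps I \<and> mle I (xs n) g) \<longrightarrow>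
      filterlim (\<lambda>n. hsize (xs n)) at_top sequentially \<longrightarrow>
      (\<lambda>n. cost \<phi> (xs n) / real (hsize (xs n))) \<longlonglongrightarrow> c"
  shows "AE g in P. (\<lambda>n. cost \<phi> (iterV I V n g) / real (hsize (iterV I V n g))) \<longlonglongrightarrow> c"
proof -
  \<comment> \<open>Countability of the finite heaps allows the quantifier inside \<open>AE\<close>,
    covering every possible iterate at once.\<close>
  have "AE g in P. \<forall>x\<in>fheaps I. mle I x g \<longrightarrow> V (hminus I g x) \<in> fheaps I"
    using AE_finite_after[OF V] ex countable_fheaps unfolding exhaustive_def
    by (subst AE_ball_countable) auto
  moreover have "AE g in P. g = Lub I (range (\<lambda>n. iterV I V n g))"
    using ex unfolding exhaustive_def by blast
  ultimately show ?thesis using conv AE_space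
  proof eventually_elim
    case (elim g)
    have g: "g \<in> bdry I" using elim(4) space_P by simp
    have it: "iterV I V n g \<in> fheaps I" "mle I (iterV I V n g) g"
      "hle I (fword (iterV I V n g)) (fword (iterV I V (Suc n) g))" for n
      using iterV_finite[OF V g] elim(1) by blast+
    have "mono (\<lambda>n. hsize (iterV I V n g))"
      unfolding mono_iff_le_Suc hsize_def using it(3) hle_length by blast
    \<comment> \<open>Since \<open>g\<close> is the supremum of its iterates, its first
      \<open>B\<close> layers, which hold at least \<open>B\<close> pieces, lie below one of
      them.\<close>
    moreover have "\<exists>n. B \<le> hsize (iterV I V n g)" for B
    proof -
      have "below g = (\<Union>n. below (iterV I V n g))"
        using Lub_increasing(2)[of "\<lambda>n. iterV I V n g"] it(1,3) elim(2) by simp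
      moreover have "pword g B \<in> below g" unfolding below_def by (auto intro: exI[of _ B])
      ultimately obtain n where "hle I (pword g B) (fword (iterV I V n g))"
        using below_fheap[OF it(1)] by blast
      then show ?thesis
        using hle_length length_pword_bdry[OF g, of B] unfolding hsize_def by (meson order_trans)
    qed
    ultimately have "filterlim (\<lambda>n. hsize (iterV I V n g)) at_top sequentially"
      unfolding filterlim_at_top eventually_sequentially by (meson monoD order_trans)
    then show ?case using it(1,2) by (intro elim(3)[rule_format, of "\<lambda>n. iterV I V n g"]) auto
  qed
qed

end

theorem theorem2:
  fixes I :: "('a::finite \<times> 'a) set" and P :: "'a cfseq measure" and \<phi> :: "'a \<Rightarrow> real"
  assumes "CARD('a) \<ge> 2"
    and "sym I" and "irrefl I"
    and "\<forall>a b. (a, b) \<in> (- I)\<^sup>*"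
    and "bernoulli I P"
  shows "\<exists>c::real. \<forall>V. AST I V \<and> exhaustive I P V \<and> (\<integral>\<^sup>+ g. hlen I (V g) \<partial>P) < \<infinity> \<longrightarrow>
           (AE g in P. (\<lambda>n. cost \<phi> (iterV I V n g) / real (hsize (iterV I V n g)))
                          \<longlonglongrightarrow> c)"
proof -
  interpret bernoulli_heaps I P using assms by unfold_locales auto
  obtain c where "AE g in P. \<forall>xs. (\<forall>n. xs n \<in> fheaps I \<and> mle I (xs n) g) \<longrightarrow>
      filterlim (\<lambda>n. hsize (xs n)) at_top sequentially \<longrightarrow>
      (\<lambda>n. cost \<phi> (xs n) / real (hsize (xs n))) \<longlonglongrightarrow> c"
    using subheap_means_converge by blast
  then show ?thesis using exhaustive_converges by blast
qed

end
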